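(* Let $X$ be an apex-forest with at least two vertices, and let $G$ be a graph. If $G$ is $X$-minor-free, then $\operatorname{lpw}(G)\leq 2|V(X)|-3$.
   Context: All graphs are finite and simple. A graph is an apex-forest if it can be made acyclic by deleting at most one vertex. A model of $H$ in $G$ is a family $(B_x\mid x\in V(H))$ of pairwise disjoint subsets of $V(G)$ such that each $G[B_x]$ is non-empty and connected, and for every edge $xy\in E(H)$ there is an edge of $G$ between $B_x$ and $B_y$; $G$ is $H$-minor-free if it contains no model of $H$. A path decomposition of $G$ is a sequence $(W_1,\dots,W_m)$ ($m\ge 1$) of subsets of $V(G)$ (bags) such that every edge of $G$ has both ends in some bag and for each vertex $v$ the set $\{i: v\in W_i\}$ is a non-empty interval. A layering of $G$ is a sequence $(L_i\mid i\geq 0)$ of pairwise disjoint subsets of $V(G)$ with union $V(G)$ such that for every edge $uv$ there is $i\ge 0$ with $u,v\in L_i\cup L_{i+1}$. The layered pathwidth $\operatorname{lpw}(G)$ is the minimum, over all path decompositions $(W_1,\dots,W_m)$ and layerings $(L_i)$ of $G$, of $\max_{i,j}|W_i\cap L_j|$. *)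

theory Defs
  imports "Graph_Theory.Digraph_Component" "HOL-Library.Disjoint_Sets"
begin

text \<open>
  A finite simple graph is a digraph satisfying the locale \<^locale>\<open>graph\<close>: finite, loop-free,
  without parallel arcs, and symmetric, so that an undirected edge is a pair of opposite arcs.
\<close>

text \<open>
  Going forth and back along an edge is a cycle of length two in the sense of
  \<^const>\<open>pre_digraph.cycle\<close>. It has to be excluded to obtain the cycles of the
  undirected graph; for the same reason \<^const>\<open>forest\<close> is not suitable for symmetric digraphs.
\<close>

definition acyclic_graph :: "('a, 'b) pre_digraph \<Rightarrow> bool" where
  "acyclic_graph G \<longleftrightarrow> \<not> (\<exists>p. pre_digraph.cycle G p \<and> length p \<ge> 3)"

definition apex_forest :: "('a, 'b) pre_digraph \<Rightarrow> bool" where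
  "apex_forest G \<longleftrightarrow>
     acyclic_graph G \<or> (\<exists>v\<in>verts G. acyclic_graph (pre_digraph.del_vert G v))"

definition minor_model ::
  "('a, 'b) pre_digraph \<Rightarrow> ('c, 'd) pre_digraph \<Rightarrow> ('a \<Rightarrow> 'c set) \<Rightarrow> bool" where
  "minor_model H G B \<longleftrightarrow>
     (\<forall>x\<in>verts H. B x \<subseteq> verts G \<and> B x \<noteq> {} \<and> connected (G \<restriction> B x)) \<and>
     disjoint_family_on B (verts H) \<and>
     (\<forall>x y. x \<rightarrow>\<^bsub>H\<^esub> y \<longrightarrow> (\<exists>u\<in>B x. \<exists>v\<in>B y. u \<rightarrow>\<^bsub>G\<^esub> v))"

definition minor_free :: "('a, 'b) pre_digraph \<Rightarrow> ('c, 'd) pre_digraph \<Rightarrow> bool" where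
  "minor_free H G \<longleftrightarrow> \<not> (\<exists>B. minor_model H G B)"

definition path_decomposition :: "('a, 'b) pre_digraph \<Rightarrow> 'a set list \<Rightarrow> bool" where
  "path_decomposition G Ws \<longleftrightarrow>
     Ws \<noteq> [] \<and>
     (\<forall>W\<in>set Ws. W \<subseteq> verts G) \<and>
     (\<forall>u v. u \<rightarrow>\<^bsub>G\<^esub> v \<longrightarrow> (\<exists>W\<in>set Ws. u \<in> W \<and> v \<in> W)) \<and>
     (\<forall>v\<in>verts G. \<exists>i j. i \<le> j \<and> {k. k < length Ws \<and> v \<in> Ws ! k} = {i..j})"

definition layering :: "('a, 'b) pre_digraph \<Rightarrow> (nat \<Rightarrow> 'a set) \<Rightarrow> bool" where
  "layering G L \<longleftrightarrow>
     disjoint_family L \<and>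
     (\<Union>i. L i) = verts G \<and>
     (\<forall>u v. u \<rightarrow>\<^bsub>G\<^esub> v \<longrightarrow> (\<exists>i. {u, v} \<subseteq> L i \<union> L (Suc i)))"

definition layered_width :: "'a set list \<Rightarrow> (nat \<Rightarrow> 'a set) \<Rightarrow> nat" where
  "layered_width Ws L = Max {card (Ws ! i \<inter> L j) | i j. i < length Ws}"

definition layered_pathwidth :: "('a, 'b) pre_digraph \<Rightarrow> nat" where
  "layered_pathwidth G =
     (LEAST k. \<exists>Ws L. path_decomposition G Ws \<and> layering G L \<and> k = layered_width Ws L)"

text \<open>
  For finite graphs the maximum ranges over a finite non-empty set although there are infinitely
  many layers, and the minimum is taken over a non-empty set.
\<close>

lemma layered_width_set_finite_nonempty:
  assumes "finite (verts G)" "path_decomposition G Ws"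
  shows "finite {card (Ws ! i \<inter> L j) | i j. i < length Ws}"
    and "{card (Ws ! i \<inter> L j) | i j. i < length Ws} \<noteq> {}"
proof -
  have "card (Ws ! i \<inter> L j) \<le> card (verts G)" if "i < length Ws" for i j
  proof (rule card_mono[OF assms(1)])
    show "Ws ! i \<inter> L j \<subseteq> verts G"
      using that assms(2) nth_mem[OF that] unfolding path_decomposition_def by blast
  qed
  then have "{card (Ws ! i \<inter> L j) | i j. i < length Ws} \<subseteq> {..card (verts G)}"
    by auto
  then show "finite {card (Ws ! i \<inter> L j) | i j. i < length Ws}"
    using finite_subset by blast
  show "{card (Ws ! i \<inter> L j) | i j. i < length Ws} \<noteq> {}"
    using assms(2) unfolding path_decomposition_def by auto
qed

lemma layered_pathwidth_attained:
  assumes "graph G"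
  shows "\<exists>Ws L. path_decomposition G Ws \<and> layering G L \<and>
           layered_pathwidth G = layered_width Ws L"
proof -
  interpret graph G by (rule assms)
  let ?L = "\<lambda>i::nat. if i = 0 then verts G else {}"
  have "path_decomposition G [verts G]"
  proof -
    have "\<exists>i j. i \<le> j \<and> {k. k < length [verts G] \<and> v \<in> [verts G] ! k} = {i..j}"
      if "v \<in> verts G" for v
    proof -
      have "{k. k < length [verts G] \<and> v \<in> [verts G] ! k} = {0..0}"
        using that by auto
      then show ?thesis by blast
    qed
    moreover have "\<exists>W\<in>set [verts G]. u \<in> W \<and> v \<in> W" if "u \<rightarrow>\<^bsub>G\<^esub> v" for u v
      using adj_in_verts[OF that] by simp
    ultimately show ?thesis
      unfolding path_decomposition_def by simp
  qed
  moreover have "layering G ?L"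
  proof -
    have "\<exists>i. {u, v} \<subseteq> ?L i \<union> ?L (Suc i)" if "u \<rightarrow>\<^bsub>G\<^esub> v" for u v
      using adj_in_verts[OF that] by (intro exI[of _ 0]) simp
    moreover have "disjoint_family ?L" "(\<Union>i. ?L i) = verts G"
      unfolding disjoint_family_on_def by (auto split: if_splits)
    ultimately show ?thesis
      unfolding layering_def by blast
  qed
  ultimately have "\<exists>k Ws L. path_decomposition G Ws \<and> layering G L \<and> k = layered_width Ws L"
    by blast
  then show ?thesis
    unfolding layered_pathwidth_def by (rule LeastI_ex)
qed

end

theory Submission
  imports Defs
begin

text \<open>
  Let \<open>F\<close> be the forest obtained from \<open>X\<close> by deleting its apex, with \<open>n\<close> vertices.
  If \<open>U\<close> is a connected set disjoint from \<open>C\<close> and \<open>S \<subseteq> C\<close> consists of neighbours of \<open>U\<close>,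
  then \<open>C\<close> has no model of \<open>F\<close> all of whose branch sets meet \<open>S\<close>, since \<open>U\<close> could serve
  as the branch set of the apex. A rooted version of Diestel's proof of the path-width theorem
  then yields a set \<open>H\<close> with \<open>S \<subseteq> H \<subseteq> C\<close> and a path decomposition of \<open>H\<close> with bags of
  size at most \<open>2 * n - 1\<close> such that each component of \<open>C - H\<close> attaches to a single bag.
  Taking \<open>H\<close> as the next layer and recursing into the components gives the result.
\<close>

section \<open>Connectors and Menger's theorem\<close>

text \<open>Only the root set \<open>S\<close> is known to be adjacent to \<open>U\<close>, so only
  models whose branch sets all reach \<open>S\<close> can be excluded. Rooting has a price:
  excluding a forest on \<open>n\<close> vertices as an ordinary minor already gives bags of size
  \<open>n - 1\<close>, whereas here a finished model may still fail to be linked to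
  \<open>S\<close>, and the separator responsible for that must share a bag with the boundary. As
  \<open>n\<close> is one less than the number of vertices of \<open>X\<close>,
  \<open>2 * n - 1\<close> is the bound claimed. The new roots are the vertices with a neighbour in
  the preceding core, so \<open>S \<subseteq> H\<close> keeps every edge within a layer or between
  consecutive ones. The obstacle in the recursion is the next apex set: \<open>H\<close> need not be
  connected, and deleting a part of \<open>C - H\<close> may cut some of \<open>H\<close> off from
  \<open>U\<close>. Components that attach to the same bag are treated together as one part, and for
  non-empty \<open>S\<close> a core of minimum size ensures that outside each part all of
  \<open>H\<close> hangs together with \<open>U\<close>.\<close>

text \<open>Connectedness of the subgraph induced by \<open>A\<close>, for symmetric \<open>E\<close>, without reference to walks.\<close>

definition conn :: "('a \<Rightarrow> 'a \<Rightarrow> bool) \<Rightarrow> 'a set \<Rightarrow> bool" where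
  "conn E A \<longleftrightarrow> (\<forall>Q\<subseteq>A. Q \<noteq> {} \<longrightarrow> (\<forall>p\<in>Q. \<forall>q\<in>A. E p q \<longrightarrow> q \<in> Q) \<longrightarrow> Q = A)"

text \<open>Takes the place of induction along a walk inside \<open>A\<close>.\<close>

lemma connD:
  assumes "conn E A" "x \<in> A" "P x" "\<And>p q. p \<in> A \<Longrightarrow> q \<in> A \<Longrightarrow> P p \<Longrightarrow> E p q \<Longrightarrow> P q" "y \<in> A"
  shows "P y"
proof -
  let ?Q = "{z \<in> A. P z}"
  have "\<forall>p\<in>?Q. \<forall>q\<in>A. E p q \<longrightarrow> q \<in> ?Q" using assms(4) by blast
  moreover have "?Q \<subseteq> A" "?Q \<noteq> {}" using assms(2,3) by blast+
  ultimately have "?Q = A" using assms(1) unfolding conn_def by meson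
  then show ?thesis using assms(5) by blast
qed

lemma connI:
  assumes "\<And>Q x. Q \<subseteq> A \<Longrightarrow> x \<in> Q \<Longrightarrow> (\<And>p q. p \<in> Q \<Longrightarrow> q \<in> A \<Longrightarrow> E p q \<Longrightarrow> q \<in> Q) \<Longrightarrow> A \<subseteq> Q"
  shows "conn E A"
  unfolding conn_def
proof (intro allI impI)
  fix Q assume Q: "Q \<subseteq> A" "Q \<noteq> {}" "\<forall>p\<in>Q. \<forall>q\<in>A. E p q \<longrightarrow> q \<in> Q"
  then obtain x where "x \<in> Q" by blast
  then have "A \<subseteq> Q" using assms[of Q x] Q by blast
  then show "Q = A" using Q by blast
qed

lemma conn_singleton [simp]: "conn E {x}"
  unfolding conn_def by blast

lemma conn_mono:
  assumes "conn E A" "\<And>x y. E x y \<Longrightarrow> E' x y"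
  shows "conn E' A"
proof (rule connI)
  fix Q x assume "Q \<subseteq> A" "x \<in> Q" and step: "\<And>p q. p \<in> Q \<Longrightarrow> q \<in> A \<Longrightarrow> E' p q \<Longrightarrow> q \<in> Q"
  then show "A \<subseteq> Q"
    using connD[OF assms(1), of x "\<lambda>u. u \<in> Q"] assms(2) by blast
qed

text \<open>The edge case joins two connectors across the deleted edge in Menger's theorem; the case
  \<open>a = b\<close> joins them at a common vertex and also attaches connectors to branch
  sets.\<close>

lemma conn_link:
  assumes "conn E A" "conn E B" "symp E"
    and "a \<in> A" "b \<in> B" "a = b \<or> E a b"
  shows "conn E (A \<union> B)"
proof (rule connI)
  fix Q x assume Q: "Q \<subseteq> A \<union> B" "x \<in> Q" "\<And>p q. p \<in> Q \<Longrightarrow> q \<in> A \<union> B \<Longrightarrow> E p q \<Longrightarrow> q \<in> Q"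
  have EA: "A \<subseteq> Q" if "z \<in> A" "z \<in> Q" for z
    using connD[OF assms(1) that(1), of "\<lambda>u. u \<in> Q"] that Q(3) by blast
  have EB: "B \<subseteq> Q" if "z \<in> B" "z \<in> Q" for z
    using connD[OF assms(2) that(1), of "\<lambda>u. u \<in> Q"] that Q(3) by blast
  have ba: "a = b \<or> E b a" using assms(3,6) by (auto dest: sympD)
  show "A \<union> B \<subseteq> Q"
  proof (cases "x \<in> A")
    case True
    then have "A \<subseteq> Q" using EA Q(2) by blast
    moreover have "b \<in> Q" using calculation assms Q(3)[of a b] by blast
    ultimately show ?thesis using EB assms(5) by blast
  next
    case False
    then have "B \<subseteq> Q" using EB Q(1,2) by blast
    moreover have "a \<in> Q" using calculation ba assms Q(3)[of b a] by blast
    ultimately show ?thesis using EA assms(4) by blast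
  qed
qed

definition separation :: "('a \<Rightarrow> 'a \<Rightarrow> bool) \<Rightarrow> 'a set \<Rightarrow> 'a set \<Rightarrow> 'a set \<Rightarrow> 'a set \<Rightarrow> 'a set \<Rightarrow> bool" where
  "separation E V A B Y Z \<longleftrightarrow>
     A \<subseteq> Y \<and> B \<subseteq> Z \<and> Y \<union> Z = V \<and> (\<forall>u\<in>Y - Z. \<forall>v\<in>Z - Y. \<not> E u v)"

text \<open>These sets stand for disjoint paths from \<open>A\<close> to \<open>B\<close>: for
  symmetric \<open>E\<close> each contains such a path, and unlike paths they are glued by taking
  unions.\<close>

definition connector_family :: "('a \<Rightarrow> 'a \<Rightarrow> bool) \<Rightarrow> 'a set \<Rightarrow> 'a set \<Rightarrow> 'a set \<Rightarrow> 'a set \<Rightarrow> ('a \<Rightarrow> 'a set) \<Rightarrow> bool" where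
  "connector_family E V A B I P \<longleftrightarrow>
     disjoint_family_on P I \<and> (\<forall>i\<in>I. P i \<subseteq> V \<and> conn E (P i) \<and> P i \<inter> A \<noteq> {} \<and> P i \<inter> B \<noteq> {})"

text \<open>Picking an element of \<open>B\<close> from each set is injective by disjointness and
  onto \<open>B\<close> by counting, so no set has room for a second element of
  \<open>B\<close>.\<close>

lemma disjoint_family_transversal:
  assumes dis: "disjoint_family_on P I" and fin: "finite I" "finite B" and card: "card I = card B"
    and meet: "\<And>i. i \<in> I \<Longrightarrow> P i \<inter> B \<noteq> {}"
  obtains g where "bij_betw g B I" "\<And>b. b \<in> B \<Longrightarrow> P (g b) \<inter> B = {b}"
proof -
  have "\<forall>i\<in>I. \<exists>b. b \<in> P i \<inter> B" using meet by blast
  then obtain f where f: "\<And>i. i \<in> I \<Longrightarrow> f i \<in> P i \<inter> B" by metis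
  have inj: "inj_on f I"
  proof (rule inj_onI)
    fix i j assume ij: "i \<in> I" "j \<in> I" "f i = f j"
    then have "f i \<in> P i \<inter> P j" using f[of i] f[of j] by auto
    then show "i = j" using dis ij unfolding disjoint_family_on_def by blast
  qed
  moreover have "f ` I \<subseteq> B" using f by blast
  ultimately have "f ` I = B" using fin card
    by (metis card_image card_subset_eq)
  then have bij: "bij_betw f I B" using inj unfolding bij_betw_def by blast
  define g where "g = the_inv_into I f"
  have g: "bij_betw g B I" unfolding g_def by (rule bij_betw_the_inv_into[OF bij])
  have fg: "f (g b) = b" "g b \<in> I" if "b \<in> B" for b
    using that bij g f_the_inv_into_f_bij_betw[OF bij, of b] unfolding g_def bij_betw_def by auto
  have "P (g b) \<inter> B = {b}" if "b \<in> B" for b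
  proof -
    have "c = b" if "c \<in> P (g b) \<inter> B" for c
    proof -
      have "c \<in> P (g b) \<inter> P (g c)" using that fg[of c] f[of "g c"] by auto
      then have "g c = g b" using dis fg(2) that \<open>b \<in> B\<close> unfolding disjoint_family_on_def by blast
      then show "c = b" using fg(1) that \<open>b \<in> B\<close> by (metis IntD2)
    qed
    moreover have "b \<in> P (g b)" using f[of "g b"] fg[OF that] by auto
    ultimately show ?thesis using that by blast
  qed
  then show thesis using that g by blast
qed

text \<open>A family as large as \<open>W\<close> uses every vertex of \<open>W\<close> once, so
  these vertices can serve as indices; two families are then glued index by index.\<close>

lemma connector_family_reindex:
  assumes "connector_family E V A B I P" "finite I" "finite W" "card I = card W"
    and "W = A \<or> W = B"
  obtains R where "connector_family E V A B W R" "\<And>w. w \<in> W \<Longrightarrow> R w \<inter> W = {w}"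
proof -
  have dis: "disjoint_family_on P I"
    and P: "\<And>i. i \<in> I \<Longrightarrow> P i \<subseteq> V \<and> conn E (P i) \<and> P i \<inter> A \<noteq> {} \<and> P i \<inter> B \<noteq> {}"
    using assms(1) unfolding connector_family_def by auto
  obtain g where g: "bij_betw g W I" "\<And>b. b \<in> W \<Longrightarrow> P (g b) \<inter> W = {b}"
    using disjoint_family_transversal[OF dis assms(2,3,4)] P assms(5) by metis
  have inI: "g w \<in> I" if "w \<in> W" for w using g(1) that by (auto simp: bij_betw_def)
  have "disjoint_family_on (\<lambda>w. P (g w)) W"
    using dis inI g(1) unfolding disjoint_family_on_def bij_betw_def inj_on_def by metis
  then have "connector_family E V A B W (\<lambda>w. P (g w))"
    unfolding connector_family_def using P inI by blast
  then show thesis using that g(2) by blast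
qed

text \<open>
  Menger's theorem, by deletion of an edge: a separation of the smaller graph of order less
  than \<open>k\<close> separates the two ends \<open>x\<close> and \<open>y\<close> of that edge, and the
  connectors found on its two sides are glued along its \<open>k - 1\<close> common vertices
  and along the deleted edge.
\<close>

theorem Menger:
  assumes "finite V" "symp E" "A \<subseteq> V" "B \<subseteq> V"
    and "\<And>Y Z. separation E V A B Y Z \<Longrightarrow> k \<le> card (Y \<inter> Z)"
  shows "\<exists>I P. finite I \<and> card I = k \<and> connector_family E V A B I P"
  using assms
proof (induction "card {e. fst e \<in> V \<and> snd e \<in> V \<and> E (fst e) (snd e)}" arbitrary: V E A B
    rule: less_induct)
  case less
  let ?ed = "\<lambda>V E. {e. fst e \<in> V \<and> snd e \<in> V \<and> E (fst e) (snd e)}"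
  note fin = less.prems(1) and sym = less.prems(2) and order = less.prems(5)
  have fined: "finite (?ed V E)"
    by (rule finite_subset[of _ "V \<times> V"]) (use fin in auto)
  show ?case
  proof (cases "\<exists>x y. x \<in> V \<and> y \<in> V \<and> E x y")
    case False
    \<comment> \<open>Without edges every cover of \<open>V\<close> is a separation; this one has
      order \<open>card (A \<inter> B)\<close>, so one-element connectors suffice.\<close>
    then have "separation E V A B A ((V - A) \<union> B)"
      using less.prems unfolding separation_def by blast
    then have "k \<le> card (A \<inter> ((V - A) \<union> B))" by (rule order)
    moreover have "A \<inter> ((V - A) \<union> B) = A \<inter> B" by blast
    ultimately obtain I where I: "I \<subseteq> A \<inter> B" "card I = k" "finite I"
      using obtain_subset_with_card_n by metis
    then have "connector_family E V A B I (\<lambda>i. {i})"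
      using less.prems(3) unfolding connector_family_def disjoint_family_on_def by auto
    then show ?thesis using I by blast
  next
    case True
    then obtain x0 y0 where xy0: "x0 \<in> V" "y0 \<in> V" "E x0 y0" by blast
    define E' where "E' u v \<longleftrightarrow> E u v \<and> {u, v} \<noteq> {x0, y0}" for u v
    have sym': "symp E'" using sym unfolding E'_def symp_def by (metis insert_commute)
    have less': "card (?ed W E') < card (?ed V E)" if "W \<subseteq> V" for W
    proof (rule psubset_card_mono[OF fined])
      have "(x0, y0) \<in> ?ed V E" "(x0, y0) \<notin> ?ed W E'" using xy0 by (auto simp: E'_def)
      moreover have "?ed W E' \<subseteq> ?ed V E" using that by (auto simp: E'_def)
      ultimately show "?ed W E' \<subset> ?ed V E" by blast
    qed
    have mono: "conn E' P \<Longrightarrow> conn E P" for P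
      by (erule conn_mono) (simp add: E'_def)
    show ?thesis
    proof (cases "\<forall>Y Z. separation E' V A B Y Z \<longrightarrow> k \<le> card (Y \<inter> Z)")
      case True
      then have "\<exists>I P. finite I \<and> card I = k \<and> connector_family E' V A B I P"
        by (intro less.hyps[OF less'] fin sym' less.prems(3,4)) auto
      then show ?thesis using mono unfolding connector_family_def by blast
    next
      case False
      then obtain Y Z where sep': "separation E' V A B Y Z" and small: "card (Y \<inter> Z) < k"
        by (meson not_le)
      have "\<not> separation E V A B Y Z" using order small by (meson not_le)
      then obtain x y where xy: "x \<in> Y - Z" "y \<in> Z - Y" "E x y"
        using sep' unfolding separation_def by blast
      then have "\<not> E' x y" using sep' unfolding separation_def by blast
      then have xy_eq: "{x, y} = {x0, y0}" using xy(3) unfolding E'_def by blast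
      have only: "u = x \<and> v = y \<or> u = y \<and> v = x" if "E u v" "\<not> E' u v" for u v
        using that xy_eq unfolding E'_def by (auto simp: doubleton_eq_iff)
      have YZ: "A \<subseteq> Y" "B \<subseteq> Z" "Y \<union> Z = V" and noE: "\<And>u v. u \<in> Y - Z \<Longrightarrow> v \<in> Z - Y \<Longrightarrow> \<not> E' u v"
        using sep' unfolding separation_def by auto
      have finYZ: "finite Y" "finite Z" using YZ fin by auto
      \<comment> \<open>The deleted edge is the only one across \<open>(Y, Z)\<close>; adding
        \<open>x\<close> to \<open>Z\<close> gives a separation of the full graph whose order is
        larger by one, so \<open>card (Y \<inter> Z)\<close> is exactly
        \<open>k - 1\<close>.\<close>
      have "separation E V A B Y (insert x Z)"
        using YZ noE only xy unfolding separation_def by blast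
      then have "k \<le> card (Y \<inter> insert x Z)" by (rule order)
      moreover have "Y \<inter> insert x Z = insert x (Y \<inter> Z)" using xy by blast
      ultimately have card_k: "Suc (card (Y \<inter> Z)) = k" using small finYZ xy by auto
      let ?BY = "insert x (Y \<inter> Z)" and ?AZ = "insert y (Y \<inter> Z)"
      have cBY: "card ?BY = k" and cAZ: "card ?AZ = k" using card_k finYZ xy by auto
      \<comment> \<open>\<open>Y\<close> inherits the hypothesis: a separation \<open>(P, Q)\<close>
        of \<open>Y\<close> extends to \<open>(P, Q \<union> Z)\<close> without change of order
        because \<open>Y \<inter> Z \<subseteq> Q\<close>, and the deleted edge does not cross it
        because \<open>x \<in> Q\<close>.\<close>
      have "\<exists>I P. finite I \<and> card I = k \<and> connector_family E' Y A ?BY I P"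
      proof (rule less.hyps[OF less'])
        fix P Q assume s: "separation E' Y A ?BY P Q"
        then have PQ: "A \<subseteq> P" "?BY \<subseteq> Q" "P \<union> Q = Y"
          and nPQ: "\<And>u v. u \<in> P - Q \<Longrightarrow> v \<in> Q - P \<Longrightarrow> \<not> E' u v"
          unfolding separation_def by auto
        have "separation E V A B P (Q \<union> Z)"
          unfolding separation_def
        proof (intro conjI ballI)
          fix u v assume u: "u \<in> P - (Q \<union> Z)" and v: "v \<in> Q \<union> Z - P"
          have "\<not> E' u v"
          proof (cases "v \<in> Q")
            case True then show ?thesis using nPQ u v by blast
          next
            case False then show ?thesis using noE PQ u v by blast
          qed
          then show "\<not> E u v" using only u v PQ xy by blast
        qed (use PQ YZ in auto)
        then have "k \<le> card (P \<inter> (Q \<union> Z))" by (rule order)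
        moreover have "P \<inter> (Q \<union> Z) = P \<inter> Q" using PQ by blast
        ultimately show "k \<le> card (P \<inter> Q)" by simp
      qed (use YZ finYZ xy sym' in auto)
      then obtain I1 P1 where "finite I1" "card I1 = k" "connector_family E' Y A ?BY I1 P1" by blast
      with cBY finYZ obtain P where P: "connector_family E' Y A ?BY ?BY P"
        "\<And>w. w \<in> ?BY \<Longrightarrow> P w \<inter> ?BY = {w}"
        by (metis connector_family_reindex finite_Int finite_insert)
      have "\<exists>I P. finite I \<and> card I = k \<and> connector_family E' Z ?AZ B I P"
      proof (rule less.hyps[OF less'])
        fix P Q assume s: "separation E' Z ?AZ B P Q"
        then have PQ: "?AZ \<subseteq> P" "B \<subseteq> Q" "P \<union> Q = Z"
          and nPQ: "\<And>u v. u \<in> P - Q \<Longrightarrow> v \<in> Q - P \<Longrightarrow> \<not> E' u v"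
          unfolding separation_def by auto
        have "separation E V A B (P \<union> Y) Q"
          unfolding separation_def
        proof (intro conjI ballI)
          fix u v assume u: "u \<in> P \<union> Y - Q" and v: "v \<in> Q - (P \<union> Y)"
          have "\<not> E' u v"
          proof (cases "u \<in> P")
            case True then show ?thesis using nPQ u v by blast
          next
            case False then show ?thesis using noE PQ u v by blast
          qed
          then show "\<not> E u v" using only u v PQ xy by blast
        qed (use PQ YZ in auto)
        then have "k \<le> card ((P \<union> Y) \<inter> Q)" by (rule order)
        moreover have "(P \<union> Y) \<inter> Q = P \<inter> Q" using PQ by blast
        ultimately show "k \<le> card (P \<inter> Q)" by simp
      qed (use YZ finYZ xy sym' in auto)
      then obtain I2 P2 where "finite I2" "card I2 = k" "connector_family E' Z ?AZ B I2 P2" by blast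
      with cAZ finYZ obtain R where R: "connector_family E' Z ?AZ B ?AZ R"
        "\<And>w. w \<in> ?AZ \<Longrightarrow> R w \<inter> ?AZ = {w}"
        by (metis connector_family_reindex finite_Int finite_insert)
      define s where "s b = (if b = x then y else b)" for b
      have s: "s b \<in> ?AZ" "b = s b \<or> E b (s b)" if "b \<in> ?BY" for b
        using that xy unfolding s_def by auto
      have s_inj: "s b \<noteq> s c" if "b \<in> ?BY" "c \<in> ?BY" "b \<noteq> c" for b c
        using that xy unfolding s_def by auto
      have Pb: "P b \<subseteq> Y" "conn E (P b)" "P b \<inter> A \<noteq> {}" "b \<in> P b" if "b \<in> ?BY" for b
        using P(1) P(2)[OF that] that mono unfolding connector_family_def by (blast+)
      have Rb: "R b \<subseteq> Z" "conn E (R b)" "R b \<inter> B \<noteq> {}" "b \<in> R b" if "b \<in> ?AZ" for b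
        using R(1) R(2)[OF that] that mono unfolding connector_family_def by (blast+)
      \<comment> \<open>The two sets lie in \<open>Y\<close> and in \<open>Z\<close>, so they can
        meet only in \<open>Y \<inter> Z\<close>, where each contains no vertex other than its own
        index.\<close>
      have PR: "P b \<inter> R (s c) = {}" if "b \<in> ?BY" "c \<in> ?BY" "b \<noteq> c" for b c
      proof (rule ccontr)
        assume "P b \<inter> R (s c) \<noteq> {}"
        then obtain z where z: "z \<in> P b" "z \<in> R (s c)" by blast
        then have zYZ: "z \<in> Y \<inter> Z" using Pb(1) Rb(1) s(1) that by blast
        then have "z = b" using P(2)[OF that(1)] z by blast
        moreover have "z = s c" using R(2)[OF s(1)[OF that(2)]] zYZ z by blast
        ultimately show False using that(3) zYZ xy unfolding s_def by (auto split: if_splits)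
      qed
      have "disjoint_family_on (\<lambda>b. P b \<union> R (s b)) ?BY"
        unfolding disjoint_family_on_def
      proof (intro ballI impI)
        fix b c assume bc: "b \<in> ?BY" "c \<in> ?BY" "b \<noteq> c"
        have "P b \<inter> P c = {}" using P(1) bc unfolding connector_family_def disjoint_family_on_def by blast
        moreover have "R (s b) \<inter> R (s c) = {}"
          using R(1) s(1) s_inj bc unfolding connector_family_def disjoint_family_on_def by blast
        ultimately show "(P b \<union> R (s b)) \<inter> (P c \<union> R (s c)) = {}"
          using PR[OF bc] PR[OF bc(2,1)] bc(3) by blast
      qed
      moreover have "conn E (P b \<union> R (s b))" if "b \<in> ?BY" for b
        using conn_link[OF Pb(2)[OF that] Rb(2)[OF s(1)[OF that]] sym] Pb(4)[OF that]
          Rb(4)[OF s(1)[OF that]] s(2)[OF that] by blast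
      moreover have "P b \<union> R (s b) \<subseteq> V" "(P b \<union> R (s b)) \<inter> A \<noteq> {}" "(P b \<union> R (s b)) \<inter> B \<noteq> {}"
        if "b \<in> ?BY" for b
        using Pb(1,3)[OF that] Rb(1,3)[OF s(1)[OF that]] YZ(3) by auto
      ultimately have "connector_family E V A B ?BY (\<lambda>b. P b \<union> R (s b))"
        unfolding connector_family_def by simp
      then show ?thesis using cBY finYZ by (intro exI conjI) simp_all
    qed
  qed
qed

section \<open>Path decompositions with a core\<close>

text \<open>
  A path decomposition is encoded by giving each vertex \<open>v\<close> the interval \<open>{l v..r v}\<close> of
  indices of the bags containing it.
\<close>

definition interval_width_le :: "('a \<Rightarrow> nat) \<Rightarrow> ('a \<Rightarrow> nat) \<Rightarrow> 'a set \<Rightarrow> nat \<Rightarrow> bool" where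
  "interval_width_le l r H k \<longleftrightarrow> (\<forall>t. card {v \<in> H. l v \<le> t \<and> t \<le> r v} \<le> k)"

text \<open>Two intervals intersect iff each begins no later than the other ends; for symmetric
  \<open>E\<close> the condition for the reversed edge supplies the second half.\<close>

definition interval_rep :: "('a \<Rightarrow> 'a \<Rightarrow> bool) \<Rightarrow> 'a set \<Rightarrow> ('a \<Rightarrow> nat) \<Rightarrow> ('a \<Rightarrow> nat) \<Rightarrow> bool" where
  "interval_rep E C l r \<longleftrightarrow>
     (\<forall>v\<in>C. l v \<le> r v) \<and> (\<forall>u\<in>C. \<forall>v\<in>C. E u v \<longrightarrow> l u \<le> r v)"

text \<open>
  Only the vertices of the core \<open>H\<close> count for the width, and each other vertex lies in exactly
  one bag. So every component outside the core has all its core neighbours in a single bag, and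
  its own decomposition can later be inserted there.
\<close>

definition core_decomposition ::
  "('a \<Rightarrow> 'a \<Rightarrow> bool) \<Rightarrow> nat \<Rightarrow> 'a set \<Rightarrow> 'a set \<Rightarrow> 'a set \<Rightarrow> ('a \<Rightarrow> nat) \<Rightarrow> ('a \<Rightarrow> nat) \<Rightarrow> bool" where
  "core_decomposition E k C S H l r \<longleftrightarrow>
     S \<subseteq> H \<and> H \<subseteq> C \<and> interval_rep E C l r \<and> (\<forall>v\<in>C - H. l v = r v) \<and> interval_width_le l r H k"

lemma interval_repD:
  assumes "interval_rep E C l r" "symp E" "u \<in> C" "v \<in> C" "E u v"
  shows "l u \<le> r v" "l v \<le> r u"
  using assms unfolding interval_rep_def symp_def by blast+

section \<open>Boundaries and good sets\<close>

definition boundary :: "('a \<Rightarrow> 'a \<Rightarrow> bool) \<Rightarrow> 'a set \<Rightarrow> 'a set \<Rightarrow> 'a set" where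
  "boundary E V X = {v \<in> X. \<exists>w\<in>V - X. E v w}"

lemma boundary_subset: "boundary E V X \<subseteq> X"
  unfolding boundary_def by blast

lemma finite_boundary: "finite X \<Longrightarrow> finite (boundary E V X)"
  using boundary_subset finite_subset by metis

text \<open>Here \<open>T\<close> is the index of the last bag; it has to contain the whole boundary.\<close>

definition good :: "('a \<Rightarrow> 'a \<Rightarrow> bool) \<Rightarrow> nat \<Rightarrow> 'a set \<Rightarrow> 'a set \<Rightarrow> 'a set \<Rightarrow> bool" where
  "good E k V S X \<longleftrightarrow> X \<subseteq> V \<and>
     (\<exists>H l r T. core_decomposition E k X (S \<inter> X \<union> boundary E V X) H l r \<and>
        (\<forall>v\<in>X. r v \<le> T) \<and> (\<forall>v\<in>boundary E V X. r v = T))"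

lemma good_subset: "good E k V S X \<Longrightarrow> X \<subseteq> V"
  unfolding good_def by blast

text \<open>One bag with index \<open>Suc T\<close> is appended. It holds the old boundary,
  prolonged from bag \<open>T\<close>, the new core vertices \<open>Z\<close> and, uncounted, all
  other new vertices. An edge between \<open>X\<close> and \<open>Y - X\<close> has its end in
  \<open>X\<close> on the old boundary, so the new bag contains it.\<close>

lemma good_extend:
  assumes fin: "finite V" and sym: "symp E" and good: "good E k V S X"
    and XY: "X \<subseteq> Y" "Y \<subseteq> V" and Z: "Z \<subseteq> Y - X" "S \<inter> (Y - X) \<subseteq> Z"
    and bd: "boundary E V Y \<subseteq> boundary E V X \<union> Z" and card: "card (boundary E V X \<union> Z) \<le> k"
  shows "good E k V S Y"
proof -
  let ?b = "boundary E V X"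
  obtain H l r T where core: "core_decomposition E k X (S \<inter> X \<union> ?b) H l r"
    and T: "\<And>v. v \<in> X \<Longrightarrow> r v \<le> T" "\<And>v. v \<in> ?b \<Longrightarrow> r v = T"
    using good unfolding good_def by blast
  have H: "S \<inter> X \<subseteq> H" "?b \<subseteq> H" "H \<subseteq> X" "interval_rep E X l r" "\<And>v. v \<in> X - H \<Longrightarrow> l v = r v"
    "\<And>t. card {v \<in> H. l v \<le> t \<and> t \<le> r v} \<le> k"
    using core unfolding core_decomposition_def interval_width_le_def by auto
  define l' where "l' v = (if v \<in> X then l v else Suc T)" for v
  define r' where "r' v = (if v \<in> X - ?b then r v else Suc T)" for v
  have bX: "?b \<subseteq> X" unfolding boundary_def by blast
  have lr: "l v \<le> r v" if "v \<in> X" for v using H(4) that unfolding interval_rep_def by blast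
  have l'T: "l' v \<le> Suc T" for v using lr[of v] T(1)[of v] unfolding l'_def by auto
  have in_b: "u \<in> ?b" if "u \<in> X" "v \<in> Y - X" "E u v \<or> E v u" for u v
    using that XY sym unfolding boundary_def symp_def by blast
  have "interval_rep E Y l' r'"
    unfolding interval_rep_def
  proof (intro conjI ballI impI)
    fix v assume "v \<in> Y" show "l' v \<le> r' v"
      using lr[of v] l'T[of v] unfolding r'_def l'_def by auto
  next
    fix u v assume uv: "u \<in> Y" "v \<in> Y" "E u v"
    show "l' u \<le> r' v"
    proof (cases "v \<in> X - ?b")
      case True
      then have "u \<in> X" using in_b uv by blast
      then show ?thesis using True interval_repD(1)[OF H(4) sym _ _ uv(3)] by (simp add: l'_def r'_def)
    next
      case False
      then show ?thesis using l'T[of u] by (auto simp: r'_def)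
    qed
  qed
  moreover have "interval_width_le l' r' (H \<union> Z) k"
    unfolding interval_width_le_def
  proof
    fix t
    have fin2: "finite H" "finite ?b" "finite Z" using H(3) bX Z XY fin by (meson Diff_subset finite_subset)+
    show "card {v \<in> H \<union> Z. l' v \<le> t \<and> t \<le> r' v} \<le> k"
    proof (cases "t \<le> T")
      case True
      have "{v \<in> H \<union> Z. l' v \<le> t \<and> t \<le> r' v} \<subseteq> {v \<in> H. l v \<le> t \<and> t \<le> r v}"
        using True H(3) Z T(2) unfolding l'_def r'_def by (auto split: if_splits)
      then have "card {v \<in> H \<union> Z. l' v \<le> t \<and> t \<le> r' v} \<le> card {v \<in> H. l v \<le> t \<and> t \<le> r v}"
        by (rule card_mono[rotated]) (use fin2 in auto)
      then show ?thesis using H(6) le_trans by blast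
    next
      case False
      have "{v \<in> H \<union> Z. l' v \<le> t \<and> t \<le> r' v} \<subseteq> ?b \<union> Z"
      proof
        fix v assume v: "v \<in> {v \<in> H \<union> Z. l' v \<le> t \<and> t \<le> r' v}"
        then show "v \<in> ?b \<union> Z" using False H(3) T(1)[of v] unfolding r'_def by (auto split: if_splits)
      qed
      then have "card {v \<in> H \<union> Z. l' v \<le> t \<and> t \<le> r' v} \<le> card (?b \<union> Z)"
        by (rule card_mono[rotated]) (use fin2 in auto)
      then show ?thesis using card by simp
    qed
  qed
  moreover have "\<forall>v\<in>Y - (H \<union> Z). l' v = r' v"
    using H(2,5) unfolding l'_def r'_def by auto
  ultimately have "core_decomposition E k Y (S \<inter> Y \<union> boundary E V Y) (H \<union> Z) l' r'"
    unfolding core_decomposition_def using H(1,2,3) XY Z bd by blast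
  moreover have "\<forall>v\<in>Y. r' v \<le> Suc T" using T(1) unfolding r'_def by (simp add: le_SucI)
  moreover have "\<forall>v\<in>boundary E V Y. r' v = Suc T" using bd Z unfolding r'_def by auto
  ultimately show ?thesis using XY(2) unfolding good_def by (intro conjI exI)
qed

text \<open>Walking through \<open>P\<close> from \<open>p\<close>, one cannot pass bag
  \<open>t\<close> without using a core vertex there: a vertex spanning several bags is in the core,
  and a non-core vertex of bag \<open>t\<close> has only neighbours that begin at \<open>t\<close>
  or earlier. The predicate \<open>\<phi>\<close> describes the vertices that have not
  passed.\<close>

lemma interval_rep_conn_meets:
  assumes rep: "interval_rep E C l r" and sym: "symp E" and P: "P \<subseteq> C" "conn E P"
    and pt: "\<And>v. v \<in> C - H \<Longrightarrow> l v = r v"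
    and p: "p \<in> P" "l p \<le> t" and w: "w \<in> P" "w \<in> H" "t \<le> r w"
  shows "\<exists>q\<in>P \<inter> H. l q \<le> t \<and> t \<le> r q"
proof (rule ccontr)
  assume "\<not> ?thesis"
  then have neg: "q \<notin> H" if "q \<in> P" "l q \<le> t" "t \<le> r q" for q using that by auto
  define \<phi> where "\<phi> q \<longleftrightarrow> r q < t \<or> q \<notin> H \<and> r q = t" for q
  have start: "\<phi> q" if "q \<in> P" "l q \<le> t" for q
  proof (cases "t \<le> r q")
    case True
    then have "q \<notin> H" using neg that by blast
    then have "l q = r q" using pt P(1) that by blast
    then show ?thesis using True that \<open>q \<notin> H\<close> unfolding \<phi>_def by simp
  next
    case False then show ?thesis unfolding \<phi>_def by simp
  qed
  have "\<phi> w"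
  proof (rule connD[OF P(2) p(1) _ _ w(1), of \<phi>])
    show "\<phi> p" using start p by blast
    fix a b assume ab: "a \<in> P" "b \<in> P" "\<phi> a" "E a b"
    then have "l b \<le> r a" using interval_repD(2)[OF rep sym _ _ ab(4)] P(1) by blast
    also have "r a \<le> t" using ab(3) unfolding \<phi>_def by auto
    finally show "\<phi> b" using start ab(2) by blast
  qed
  then show False using w unfolding \<phi>_def by simp
qed

text \<open>
  A vertex on the boundary of \<open>Y\<close> gets the union of the intervals of its connector as its new
  interval; the bags do not grow because every bag met by this union contains a core vertex of the
  connector.
\<close>

lemma good_shrink:
  assumes fin: "finite V" and sym: "symp E" and good: "good E k V S W" and YW: "Y \<subseteq> W"
    and fam: "connector_family E (W - (Y - boundary E V Y)) (boundary E V Y) (boundary E V W) (boundary E V Y) P"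
    and P1: "\<And>y. y \<in> boundary E V Y \<Longrightarrow> P y \<inter> boundary E V Y = {y}"
  shows "good E k V S Y"
proof -
  let ?b = "boundary E V Y"
  obtain H l r T where WV: "W \<subseteq> V" and core: "core_decomposition E k W (S \<inter> W \<union> boundary E V W) H l r"
    and T: "\<And>v. v \<in> W \<Longrightarrow> r v \<le> T" "\<And>v. v \<in> boundary E V W \<Longrightarrow> r v = T"
    using good unfolding good_def by blast
  have H: "S \<inter> W \<subseteq> H" "boundary E V W \<subseteq> H" "H \<subseteq> W" "interval_rep E W l r" "\<And>v. v \<in> W - H \<Longrightarrow> l v = r v"
    "\<And>t. card {v \<in> H. l v \<le> t \<and> t \<le> r v} \<le> k"
    using core unfolding core_decomposition_def interval_width_le_def by auto
  have bY: "?b \<subseteq> Y" unfolding boundary_def by blast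
  have dis: "disjoint_family_on P ?b"
    and P: "\<And>y. y \<in> ?b \<Longrightarrow> P y \<subseteq> W - (Y - ?b)" "\<And>y. y \<in> ?b \<Longrightarrow> conn E (P y)"
      "\<And>y. y \<in> ?b \<Longrightarrow> P y \<inter> boundary E V W \<noteq> {}"
    using fam unfolding connector_family_def by auto
  have PY: "P y \<inter> Y = {y}" if "y \<in> ?b" for y using P(1) P1 that bY by blast
  have finP: "finite (P y)" if "y \<in> ?b" for y
    using P(1)[OF that] WV fin by (meson Diff_subset finite_subset)
  define l' where "l' v = (if v \<in> ?b then Min (l ` P v) else l v)" for v
  \<comment> \<open>\<open>T\<close> is the right end of the union: the connector meets the boundary
    of \<open>W\<close>, whose vertices all end in bag \<open>T\<close>.\<close>
  define r' where "r' v = (if v \<in> ?b then T else r v)" for v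
  have l'l: "l' v \<le> l v" for v
    using PY[of v] finP[of v] unfolding l'_def by (auto intro!: Min_le)
  have r'r: "r v \<le> r' v" if "v \<in> W" for v using T(1) that unfolding r'_def by simp
  have "interval_rep E Y l' r'"
    unfolding interval_rep_def
  proof (intro conjI ballI impI)
    fix v assume "v \<in> Y"
    then show "l' v \<le> r' v"
      using H(4) l'l[of v] r'r[of v] YW unfolding interval_rep_def by force
  next
    fix u v assume "u \<in> Y" "v \<in> Y" "E u v"
    then show "l' u \<le> r' v"
      using interval_repD(1)[OF H(4) sym, of u v] l'l[of u] r'r[of v] YW by force
  qed
  moreover have "interval_width_le l' r' (H \<inter> Y \<union> ?b) k"
    unfolding interval_width_le_def
  proof
    fix t
    let ?A = "{v \<in> H \<inter> Y \<union> ?b. l' v \<le> t \<and> t \<le> r' v}"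
    have "\<exists>q. q \<in> P v \<inter> H \<and> l q \<le> t \<and> t \<le> r q" if v: "v \<in> ?A" and vb: "v \<in> ?b" for v
    proof -
      have "Min (l ` P v) \<in> l ` P v" using finP PY vb by (intro Min_in) auto
      then obtain p where p: "p \<in> P v" "l p = Min (l ` P v)" by auto
      then have "l p \<le> t" using v vb unfolding l'_def by simp
      moreover obtain w where w: "w \<in> P v" "w \<in> boundary E V W" using P(3)[OF vb] by blast
      moreover have "P v \<subseteq> W" using P(1)[OF vb] by blast
      moreover have "t \<le> r w" using v vb w(2) T(2) unfolding r'_def by simp
      ultimately have "\<exists>q\<in>P v \<inter> H. l q \<le> t \<and> t \<le> r q"
        using H(2) by (intro interval_rep_conn_meets[OF H(4) sym _ P(2)[OF vb] H(5) p(1)]) auto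
      then show ?thesis by blast
    qed
    then obtain q where "\<forall>v\<in>?A \<inter> ?b. q v \<in> P v \<inter> H \<and> l (q v) \<le> t \<and> t \<le> r (q v)"
      using bchoice[of "?A \<inter> ?b" "\<lambda>v q. q \<in> P v \<inter> H \<and> l q \<le> t \<and> t \<le> r q"] by fast
    then have q: "q v \<in> P v \<inter> H \<and> l (q v) \<le> t \<and> t \<le> r (q v)" if "v \<in> ?A" "v \<in> ?b" for v
      using that by (elim ballE) auto
    \<comment> \<open>A new bag is mapped injectively into the old one: a boundary vertex goes to a
      core vertex of its connector, any other vertex to itself. No clash arises, as connectors are
      disjoint and \<open>P y\<close> meets \<open>Y\<close> only in \<open>y\<close>.\<close>
    define g where "g v = (if v \<in> ?b then q v else v)" for v
    have gP: "g v \<in> P v" if "v \<in> ?A" "v \<in> ?b" for v using q[OF that] that unfolding g_def by auto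
    have "inj_on g ?A"
    proof (rule inj_onI)
      fix u v assume uv: "u \<in> ?A" "v \<in> ?A" "g u = g v"
      consider "u \<in> ?b" "v \<in> ?b" | "u \<in> ?b" "v \<notin> ?b" | "u \<notin> ?b" "v \<in> ?b" | "u \<notin> ?b" "v \<notin> ?b" by blast
      then show "u = v"
      proof cases
        case 1
        then have "g u \<in> P u \<inter> P v" using gP uv by (metis IntI)
        then show ?thesis using 1 dis unfolding disjoint_family_on_def by blast
      next
        case 2
        then have "v \<in> P u" "v \<in> Y" using gP[OF uv(1) 2(1)] uv unfolding g_def by auto
        then show ?thesis using PY[OF 2(1)] by (metis IntI singletonD)
      next
        case 3
        then have "u \<in> P v" "u \<in> Y" using gP[OF uv(2) 3(2)] uv unfolding g_def by auto
        then show ?thesis using PY[OF 3(2)] by (metis IntI singletonD)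
      next
        case 4 then show ?thesis using uv unfolding g_def by simp
      qed
    qed
    moreover have "g ` ?A \<subseteq> {v \<in> H. l v \<le> t \<and> t \<le> r v}"
    proof
      fix x assume "x \<in> g ` ?A"
      then obtain v where v: "v \<in> ?A" "x = g v" by blast
      show "x \<in> {v \<in> H. l v \<le> t \<and> t \<le> r v}"
      proof (cases "v \<in> ?b")
        case True
        then show ?thesis using q[OF v(1)] v(2) unfolding g_def by auto
      next
        case False
        then show ?thesis using v unfolding g_def l'_def r'_def by auto
      qed
    qed
    moreover have "finite {v \<in> H. l v \<le> t \<and> t \<le> r v}"
      using finite_subset[OF H(3)] finite_subset[OF WV fin] by simp
    ultimately have "card ?A \<le> card {v \<in> H. l v \<le> t \<and> t \<le> r v}" by (rule card_inj_on_le[of g])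
    then show "card ?A \<le> k" using H(6) le_trans by blast
  qed
  moreover have "\<forall>v\<in>Y - (H \<inter> Y \<union> ?b). l' v = r' v"
    using H(5) YW unfolding l'_def r'_def by auto
  moreover have "S \<inter> Y \<union> ?b \<subseteq> H \<inter> Y \<union> ?b" using H(1) YW by blast
  moreover have "H \<inter> Y \<union> ?b \<subseteq> Y" using bY by blast
  ultimately have "core_decomposition E k Y (S \<inter> Y \<union> ?b) (H \<inter> Y \<union> ?b) l' r'"
    unfolding core_decomposition_def by (intro conjI)
  moreover have "\<forall>v\<in>Y. r' v \<le> T" using T(1) YW unfolding r'_def by auto
  moreover have "\<forall>v\<in>?b. r' v = T" unfolding r'_def by simp
  moreover have "Y \<subseteq> V" using YW WV by blast
  ultimately show ?thesis unfolding good_def by (intro conjI exI)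
qed

text \<open>For a separation \<open>(A, B)\<close> as in Menger's theorem,
  \<open>Y \<union> A\<close> lies between \<open>Y\<close> and \<open>W\<close> and has its
  boundary inside \<open>A \<inter> B\<close>, so \<open>min\<close> bounds the order from below.
  The connectors avoid the interior of \<open>Y\<close>, so they can be attached to models inside
  \<open>Y\<close>.\<close>

lemma connectors_between_boundaries:
  assumes fin: "finite V" and sym: "symp E" and YW: "Y \<subseteq> W" "W \<subseteq> V"
    and min: "\<And>Y'. Y \<subseteq> Y' \<Longrightarrow> Y' \<subseteq> W \<Longrightarrow> card (boundary E V Y) \<le> card (boundary E V Y')"
  obtains P where
    "connector_family E (W - (Y - boundary E V Y)) (boundary E V Y) (boundary E V W) (boundary E V Y) P"
    "\<And>y. y \<in> boundary E V Y \<Longrightarrow> P y \<inter> boundary E V Y = {y}"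
proof -
  let ?b = "boundary E V Y" and ?c = "boundary E V W"
  let ?U = "W - (Y - ?b)"
  have bY: "?b \<subseteq> Y" and cW: "?c \<subseteq> W" unfolding boundary_def by blast+
  have cY: "?c \<inter> Y \<subseteq> ?b" using YW unfolding boundary_def by blast
  have finU: "finite ?U" and finb: "finite ?b" using fin YW bY by (meson Diff_subset finite_subset subset_trans)+
  have "\<exists>I P. finite I \<and> card I = card ?b \<and> connector_family E ?U ?b ?c I P"
  proof (rule Menger[OF finU sym])
    fix A B assume "separation E ?U ?b ?c A B"
    then have AB: "?b \<subseteq> A" "?c \<subseteq> B" "A \<union> B = ?U" "\<And>u v. u \<in> A - B \<Longrightarrow> v \<in> B - A \<Longrightarrow> \<not> E u v"
      unfolding separation_def by auto
    have sub: "boundary E V (Y \<union> A) \<subseteq> A \<inter> B"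
    proof
      fix y assume "y \<in> boundary E V (Y \<union> A)"
      then obtain w where w: "y \<in> Y \<union> A" "w \<in> V - (Y \<union> A)" "E y w" unfolding boundary_def by blast
      have yA: "y \<in> A"
      proof (cases "y \<in> Y")
        case True
        then have "y \<in> ?b" using w unfolding boundary_def by blast
        then show ?thesis using AB by blast
      qed (use w in blast)
      have "y \<in> B"
      proof (cases "w \<in> W")
        case True
        then have "w \<in> B - A" using w AB by blast
        then show ?thesis using AB(4)[of y w] w yA by blast
      next
        case False
        then have "y \<in> ?c" using w yA AB unfolding boundary_def by blast
        then show ?thesis using AB by blast
      qed
      then show "y \<in> A \<inter> B" using yA by blast
    qed
    have "card ?b \<le> card (boundary E V (Y \<union> A))"
      using AB YW by (intro min) auto
    also have "\<dots> \<le> card (A \<inter> B)"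
      using sub AB finU by (intro card_mono) (metis finite_Int finite_Un, blast)
    finally show "card ?b \<le> card (A \<inter> B)" .
  qed (use bY cW cY YW in auto)
  then obtain I P where I: "finite I" "card I = card ?b" "connector_family E ?U ?b ?c I P" by blast
  show thesis using connector_family_reindex[OF I(3) I(1) finb I(2)] that by blast
qed

section \<open>Rooted models of trees\<close>

definition maximal_good :: "('a \<Rightarrow> 'a \<Rightarrow> bool) \<Rightarrow> nat \<Rightarrow> 'a set \<Rightarrow> 'a set \<Rightarrow> nat \<Rightarrow> 'a set \<Rightarrow> bool" where
  "maximal_good E k V S i X \<longleftrightarrow> good E k V S X \<and> card (boundary E V X) \<le> i \<and>
     (\<forall>Y. X \<subset> Y \<longrightarrow> good E k V S Y \<longrightarrow> i < card (boundary E V Y))"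

text \<open>
  The tree on \<open>{..<n}\<close> has the edges between \<open>i\<close> and \<open>par i\<close> for \<open>0 < i\<close>.
\<close>

definition tree_model ::
  "('a \<Rightarrow> 'a \<Rightarrow> bool) \<Rightarrow> (nat \<Rightarrow> nat) \<Rightarrow> nat \<Rightarrow> 'a set \<Rightarrow> 'a set \<Rightarrow> (nat \<Rightarrow> 'a set) \<Rightarrow> bool" where
  "tree_model E par n V S B \<longleftrightarrow>
     disjoint_family_on B {..<n} \<and>
     (\<forall>i<n. B i \<subseteq> V \<and> conn E (B i) \<and> B i \<inter> S \<noteq> {}) \<and>
     (\<forall>i<n. 0 < i \<longrightarrow> (\<exists>u\<in>B (par i). \<exists>v\<in>B i. E u v))"

lemma ex_maximal_good:
  assumes "finite V" "good E k V S X" "card (boundary E V X) \<le> i"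
  obtains Y where "X \<subseteq> Y" "maximal_good E k V S i Y"
proof -
  let ?\<G> = "{Y. good E k V S Y \<and> card (boundary E V Y) \<le> i}"
  have "finite ?\<G>"
    by (rule finite_subset[of _ "Pow V"]) (use assms(1) in \<open>auto simp: good_def\<close>)
  moreover have "X \<in> ?\<G>" using assms(2,3) by simp
  ultimately obtain Y where Y: "Y \<in> ?\<G>" "X \<subseteq> Y" "\<forall>Z\<in>?\<G>. Y \<subseteq> Z \<longrightarrow> Y = Z"
    using finite_has_maximal2[of ?\<G> X] by meson
  have "maximal_good E k V S i Y"
    unfolding maximal_good_def
  proof (intro conjI allI impI)
    fix Z assume "Y \<subset> Z" "good E k V S Z"
    then show "i < card (boundary E V Z)" using Y(3) by (fastforce simp: not_le[symmetric])
  qed (use Y(1) in auto)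
  then show thesis using that Y(2) by blast
qed

lemma good_empty: "good E k V S {}"
  unfolding good_def core_decomposition_def interval_rep_def interval_width_le_def boundary_def by auto

lemma good_insert:
  assumes "finite V" "symp E" "good E k V S X" "card (boundary E V X) < k" "v \<in> V - X"
  shows "good E k V S (insert v X)"
proof (rule good_extend[OF assms(1-3), where Z = "{v}"])
  have "card (boundary E V X \<union> {v}) \<le> Suc (card (boundary E V X))"
    using card_Un_le[of "boundary E V X" "{v}"] by simp
  then show "card (boundary E V X \<union> {v}) \<le> k" using assms(4) by simp
  show "boundary E V (insert v X) \<subseteq> boundary E V X \<union> {v}" unfolding boundary_def by blast
qed (use assms in \<open>auto simp: good_def\<close>)

text \<open>The branch set of \<open>par i\<close> meets the boundary, hence has a neighbour
  \<open>v\<close> outside \<open>X\<close>, and \<open>{v}\<close> becomes branch set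
  \<open>i\<close>. Maximality keeps the old roots: \<open>insert v X\<close> is good again, so its
  boundary has more than \<open>i\<close> vertices, which forces it to be the old boundary together
  with \<open>v\<close>.\<close>

lemma tree_model_grow:
  assumes fin: "finite V" and sym: "symp E" and max: "maximal_good E k V S i X" and ik: "i < k"
    and XV: "X \<noteq> V" and par: "\<And>j. 0 < j \<Longrightarrow> par j < j"
    and model: "tree_model E par i X (boundary E V X) B"
  obtains v B' where "v \<in> V - X" "boundary E V (insert v X) = insert v (boundary E V X)"
    "card (boundary E V X) = i"
    "tree_model E par (Suc i) (insert v X) (boundary E V (insert v X)) B'"
proof -
  let ?b = "boundary E V X"
  have good: "good E k V S X" and bi: "card ?b \<le> i"
    and maxX: "\<And>Y. X \<subset> Y \<Longrightarrow> good E k V S Y \<Longrightarrow> i < card (boundary E V Y)"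
    using max unfolding maximal_good_def by auto
  have X: "X \<subset> V" using good_subset[OF good] XV by blast
  have finb: "finite ?b" using X fin by (meson finite_boundary finite_subset psubset_imp_subset)
  have ins: "boundary E V (insert v X) = insert v ?b \<and> card ?b = i" if v: "v \<in> V - X" for v
  proof -
    have sub: "boundary E V (insert v X) \<subseteq> insert v ?b" unfolding boundary_def by blast
    have "i < card (boundary E V (insert v X))"
      using maxX[of "insert v X"] good_insert[OF fin sym good _ v] bi ik v by auto
    moreover have "card (boundary E V (insert v X)) \<le> card (insert v ?b)"
      using sub finb by (intro card_mono) auto
    moreover have "card (insert v ?b) \<le> Suc (card ?b)" using finb by (simp add: card_insert_if)
    ultimately have "card ?b = i" "card (insert v ?b) \<le> card (boundary E V (insert v X))" using bi by linarith+
    then show ?thesis using sub finb by (meson card_seteq finite_insert)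
  qed
  have dis: "disjoint_family_on B {..<i}"
    and B: "\<And>j. j < i \<Longrightarrow> B j \<subseteq> X" "\<And>j. j < i \<Longrightarrow> conn E (B j)" "\<And>j. j < i \<Longrightarrow> B j \<inter> ?b \<noteq> {}"
      "\<And>j. j < i \<Longrightarrow> 0 < j \<Longrightarrow> \<exists>u\<in>B (par j). \<exists>v\<in>B j. E u v"
    using model unfolding tree_model_def by auto
  obtain v where v: "v \<in> V - X" "0 < i \<Longrightarrow> \<exists>u\<in>B (par i). E u v"
  proof (cases "0 < i")
    case True
    then obtain u where "u \<in> B (par i)" "u \<in> ?b" using B(3)[OF par[OF True]] by blast
    then show ?thesis using that unfolding boundary_def by blast
  next
    case False
    then show ?thesis using X that by blast
  qed
  have bv: "boundary E V (insert v X) = insert v ?b" and bi: "card ?b = i" using ins[OF v(1)] by auto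
  have B': "tree_model E par (Suc i) (insert v X) (boundary E V (insert v X)) (B(i := {v}))"
    unfolding tree_model_def
  proof (intro conjI allI impI)
    show "disjoint_family_on (B(i := {v})) {..<Suc i}"
      unfolding disjoint_family_on_def
    proof (intro ballI impI)
      fix a b assume ab: "a \<in> {..<Suc i}" "b \<in> {..<Suc i}" "a \<noteq> b"
      have "v \<notin> B j" if "j < i" for j using B(1)[OF that] v(1) by blast
      moreover have "B a \<inter> B b = {}" if "a < i" "b < i"
        using dis ab(3) that unfolding disjoint_family_on_def by blast
      ultimately show "(B(i := {v})) a \<inter> (B(i := {v})) b = {}" using ab by (auto simp: less_Suc_eq)
    qed
  next
    fix j assume j: "j < Suc i"
    show "(B(i := {v})) j \<subseteq> insert v X" "conn E ((B(i := {v})) j)"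
      "(B(i := {v})) j \<inter> boundary E V (insert v X) \<noteq> {}"
      using j B(1,2,3)[of j] bv by (auto simp: less_Suc_eq)
    assume "0 < j"
    show "\<exists>u\<in>(B(i := {v})) (par j). \<exists>w\<in>(B(i := {v})) j. E u w"
    proof (cases "j = i")
      case True
      then have "par i \<noteq> i" using par[of i] \<open>0 < j\<close> by simp
      then show ?thesis using v(2) True \<open>0 < j\<close> by auto
    next
      case False
      then have "j < i" "par j < i" using j par[OF \<open>0 < j\<close>] by auto
      then show ?thesis using B(4)[OF _ \<open>0 < j\<close>] by auto
    qed
  qed
  show thesis by (rule that[OF v(1) bv bi B'])
qed


text \<open>The connectors carry the roots from \<open>A\<close> to \<open>C\<close>: each branch
  set absorbs the connector of one of its vertices in \<open>A\<close>. That connector meets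
  \<open>X\<close> only in this vertex, so it avoids the other branch sets.\<close>

lemma tree_model_extend:
  assumes sym: "symp E" and model: "tree_model E par m X A B" and AX: "A \<subseteq> X" and UX: "U \<inter> X \<subseteq> A"
    and fam: "connector_family E U A C A P" and P1: "\<And>a. a \<in> A \<Longrightarrow> P a \<inter> A = {a}"
    and par: "\<And>j. 0 < j \<Longrightarrow> par j < j"
  obtains B' where "tree_model E par m (X \<union> U) C B'"
proof -
  have dis: "disjoint_family_on B {..<m}"
    and B: "\<And>j. j < m \<Longrightarrow> B j \<subseteq> X" "\<And>j. j < m \<Longrightarrow> conn E (B j)" "\<And>j. j < m \<Longrightarrow> B j \<inter> A \<noteq> {}"
      "\<And>j. j < m \<Longrightarrow> 0 < j \<Longrightarrow> \<exists>u\<in>B (par j). \<exists>v\<in>B j. E u v"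
    using model unfolding tree_model_def by auto
  have disP: "disjoint_family_on P A"
    and P: "\<And>a. a \<in> A \<Longrightarrow> P a \<subseteq> U" "\<And>a. a \<in> A \<Longrightarrow> conn E (P a)" "\<And>a. a \<in> A \<Longrightarrow> P a \<inter> C \<noteq> {}"
    using fam unfolding connector_family_def by auto
  have PX: "P a \<inter> X = {a}" if "a \<in> A" for a using P(1) P1 that AX UX by blast
  define x where "x j = (SOME a. a \<in> B j \<inter> A)" for j
  have x: "x j \<in> B j" "x j \<in> A" if "j < m" for j
    using someI_ex[of "\<lambda>a. a \<in> B j \<inter> A"] B(3)[OF that] unfolding x_def by auto
  let ?B = "\<lambda>j. B j \<union> P (x j)"
  have "tree_model E par m (X \<union> U) C ?B"
    unfolding tree_model_def
  proof (intro conjI allI impI)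
    show "disjoint_family_on ?B {..<m}"
      unfolding disjoint_family_on_def
    proof (intro ballI impI)
      fix i j assume ij: "i \<in> {..<m}" "j \<in> {..<m}" "i \<noteq> j"
      then have Bij: "B i \<inter> B j = {}" using dis unfolding disjoint_family_on_def by blast
      have BP: "B i' \<inter> P (x j') \<subseteq> B i' \<inter> B j'" if "i' < m" "j' < m" for i' j'
      proof
        fix y assume y: "y \<in> B i' \<inter> P (x j')"
        then have "y \<in> P (x j') \<inter> X" using B(1)[OF that(1)] by blast
        then have "y = x j'" using PX[OF x(2)[OF that(2)]] by simp
        then show "y \<in> B i' \<inter> B j'" using y x(1)[OF that(2)] by simp
      qed
      have "x i \<noteq> x j" using x(1)[of i] x(1)[of j] ij Bij by auto
      then have "P (x i) \<inter> P (x j) = {}"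
        using disP x(2)[of i] x(2)[of j] ij unfolding disjoint_family_on_def by blast
      then show "?B i \<inter> ?B j = {}" using Bij BP[of i j] BP[of j i] ij by auto
    qed
  next
    fix j assume j: "j < m"
    show "?B j \<subseteq> X \<union> U" using B(1)[OF j] P(1)[OF x(2)[OF j]] by blast
    show "?B j \<inter> C \<noteq> {}" using P(3)[OF x(2)[OF j]] by blast
    have "x j \<in> P (x j)" using P1[OF x(2)[OF j]] by blast
    then show "conn E (?B j)"
      using conn_link[OF B(2)[OF j] P(2)[OF x(2)[OF j]] sym x(1)[OF j]] by blast
    assume "0 < j"
    then show "\<exists>u\<in>?B (par j). \<exists>v\<in>?B j. E u v" using B(4)[OF j] by blast
  qed
  then show thesis by (rule that)
qed

text \<open>
  The connectors exist since a set between \<open>insert v X\<close> and \<open>W\<close> with a smaller boundary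
  would, when its boundary is smallest possible, be good by shrinking \<open>W\<close>, against the
  maximality of \<open>X\<close>.
\<close>

lemma ex_maximal_good_tree_model:
  assumes fin: "finite V" and sym: "symp E" and par: "\<And>j. 0 < j \<Longrightarrow> par j < j"
    and bad: "\<not> good E k V S V" and "i \<le> k"
  shows "\<exists>X B. maximal_good E k V S i X \<and> tree_model E par i X (boundary E V X) B"
  using \<open>i \<le> k\<close>
proof (induction i)
  case 0
  have "boundary E V {} = {}" unfolding boundary_def by simp
  then obtain X where "maximal_good E k V S 0 X"
    using ex_maximal_good[OF fin good_empty[of E k V S], of 0] by auto
  then show ?case unfolding tree_model_def disjoint_family_on_def by auto
next
  case (Suc i)
  then obtain X B where X: "maximal_good E k V S i X" "tree_model E par i X (boundary E V X) B" by auto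
  have XV: "X \<noteq> V" using X(1) bad unfolding maximal_good_def by blast
  obtain v B' where v: "v \<in> V - X" and bv: "boundary E V (insert v X) = insert v (boundary E V X)"
    and cb: "card (boundary E V X) = i"
    and B': "tree_model E par (Suc i) (insert v X) (boundary E V (insert v X)) B'"
    by (rule tree_model_grow[OF fin sym X(1) _ XV par X(2)]) (use Suc.prems in auto)
  let ?X = "insert v X"
  have good: "good E k V S X" and maxX: "\<And>Y. X \<subset> Y \<Longrightarrow> good E k V S Y \<Longrightarrow> i < card (boundary E V Y)"
    using X(1) unfolding maximal_good_def by auto
  have goodX': "good E k V S ?X" using good_insert[OF fin sym good _ v] cb Suc.prems by simp
  have "finite (boundary E V X)"
    using good_subset[OF good] fin by (meson finite_boundary finite_subset)
  moreover have "v \<notin> boundary E V X" using v unfolding boundary_def by blast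
  ultimately have cb': "card (boundary E V ?X) = Suc i" using bv cb by simp
  obtain W where W: "?X \<subseteq> W" "maximal_good E k V S (Suc i) W"
    using ex_maximal_good[OF fin goodX', of "Suc i"] cb' by auto
  have goodW: "good E k V S W" using W(2) unfolding maximal_good_def by blast
  then have WV: "W \<subseteq> V" by (rule good_subset)
  obtain Y where Y: "?X \<subseteq> Y" "Y \<subseteq> W"
    and minY: "\<And>Z. ?X \<subseteq> Z \<Longrightarrow> Z \<subseteq> W \<Longrightarrow> card (boundary E V Y) \<le> card (boundary E V Z)"
    using ex_has_least_nat[of "\<lambda>Z. ?X \<subseteq> Z \<and> Z \<subseteq> W" ?X "\<lambda>Z. card (boundary E V Z)"] W(1) by auto
  obtain P where P: "connector_family E (W - (Y - boundary E V Y)) (boundary E V Y) (boundary E V W) (boundary E V Y) P"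
    "\<And>y. y \<in> boundary E V Y \<Longrightarrow> P y \<inter> boundary E V Y = {y}"
    by (rule connectors_between_boundaries[OF fin sym Y(2) WV minY]) (use Y(1) in auto)
  have "good E k V S Y" by (rule good_shrink[OF fin sym goodW Y(2) P])
  moreover have "X \<subset> Y" using Y(1) v by blast
  ultimately have "Suc i \<le> card (boundary E V Y)" using maxX by (simp add: Suc_le_eq)
  then have minX': "card (boundary E V ?X) \<le> card (boundary E V Z)" if "?X \<subseteq> Z" "Z \<subseteq> W" for Z
    using minY[OF that] cb' by simp
  \<comment> \<open>No set between \<open>insert v X\<close> and \<open>W\<close> has a smaller
    boundary than \<open>insert v X\<close> itself, so a second family of connectors exists; this
    one moves the roots to the boundary of \<open>W\<close>.\<close>
  obtain Q where Q: "connector_family E (W - (?X - boundary E V ?X)) (boundary E V ?X) (boundary E V W) (boundary E V ?X) Q"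
    "\<And>y. y \<in> boundary E V ?X \<Longrightarrow> Q y \<inter> boundary E V ?X = {y}"
    by (rule connectors_between_boundaries[OF fin sym W(1) WV minX']) auto
  obtain B'' where "tree_model E par (Suc i) (?X \<union> (W - (?X - boundary E V ?X))) (boundary E V W) B''"
    by (rule tree_model_extend[OF sym B' boundary_subset _ Q par]) auto
  moreover have "?X \<union> (W - (?X - boundary E V ?X)) = W" using W(1) by blast
  ultimately show ?case using W(2) by metis
qed

text \<open>
  If the \<open>n\<close> boundary vertices of the last step cannot be connected to \<open>S\<close>, a separator of
  size at most \<open>n - 1\<close> can be put into a common bag with them. This is where the width
  \<open>n + (n - 1)\<close> comes from.
\<close>

theorem core_decomposition_or_rooted_tree_model:
  assumes fin: "finite V" and sym: "symp E" and SV: "S \<subseteq> V"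
    and par: "\<And>j. 0 < j \<Longrightarrow> par j < j" and n: "0 < n"
    and nomodel: "\<And>B. \<not> tree_model E par n V S B"
  obtains H l r where "core_decomposition E (2 * n - 1) V S H l r"
proof -
  let ?k = "2 * n - 1"
  \<comment> \<open>The boundary of \<open>V\<close> is empty, so goodness of \<open>V\<close>
    supplies the decomposition with roots \<open>S\<close>.\<close>
  have "good E ?k V S V"
  proof (rule ccontr)
    assume bad: "\<not> good E ?k V S V"
    obtain X B where X: "maximal_good E ?k V S (n - 1) X" "tree_model E par (n - 1) X (boundary E V X) B"
      using ex_maximal_good_tree_model[OF fin sym par bad, of "n - 1"] n by (metis diff_le_mono le_add1 mult_2)
    have XV: "X \<noteq> V" using X(1) bad unfolding maximal_good_def by blast
    obtain v B' where v: "v \<in> V - X" and bv: "boundary E V (insert v X) = insert v (boundary E V X)"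
      and cb: "card (boundary E V X) = n - 1"
      and B': "tree_model E par (Suc (n - 1)) (insert v X) (boundary E V (insert v X)) B'"
      by (rule tree_model_grow[OF fin sym X(1) _ XV par X(2)]) (use n in auto)
    let ?X = "insert v X" let ?b = "boundary E V X" let ?b' = "boundary E V (insert v X)"
    have good: "good E ?k V S X" and maxX: "\<And>Y. X \<subset> Y \<Longrightarrow> good E ?k V S Y \<Longrightarrow> n - 1 < card (boundary E V Y)"
      using X(1) unfolding maximal_good_def by auto
    have X_V: "X \<subseteq> V" by (rule good_subset[OF good])
    have finb: "finite ?b" using X_V fin by (meson finite_boundary finite_subset)
    moreover have "v \<notin> ?b" using v unfolding boundary_def by blast
    ultimately have cb': "card ?b' = n" using bv cb n by simp
    let ?U = "V - (?X - ?b')"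
    have finU: "finite ?U" using fin by simp
    \<comment> \<open>The connectors have to avoid the rest of the model, so they run inside
      \<open>?U\<close> and can end only at roots in \<open>?U\<close>.\<close>
    have "\<exists>I P. finite I \<and> card I = n \<and> connector_family E ?U ?b' (S \<inter> ?U) I P"
    proof (rule Menger[OF finU sym])
      fix Y Z assume "separation E ?U ?b' (S \<inter> ?U) Y Z"
      then have YZ: "?b' \<subseteq> Y" "S \<inter> ?U \<subseteq> Z" "Y \<union> Z = ?U" "\<And>u w. u \<in> Y - Z \<Longrightarrow> w \<in> Z - Y \<Longrightarrow> \<not> E u w"
        unfolding separation_def by auto
      show "n \<le> card (Y \<inter> Z)"
      proof (rule ccontr)
        assume "\<not> n \<le> card (Y \<inter> Z)"
        then have small: "card (Y \<inter> Z) \<le> n - 1" by simp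
        have finYZ: "finite (Y \<inter> Z)" using YZ(3) finU by (metis finite_Int finite_Un)
        have b1: "boundary E V (?X \<union> Y) \<subseteq> Y \<inter> Z"
        proof
          fix y assume "y \<in> boundary E V (?X \<union> Y)"
          then obtain w where w: "y \<in> ?X \<union> Y" "w \<in> V - (?X \<union> Y)" "E y w" unfolding boundary_def by blast
          have "y \<in> ?X \<Longrightarrow> y \<in> ?b'" using w unfolding boundary_def by blast
          then have "y \<in> Y" using w YZ(1) by blast
          moreover have "w \<in> Z - Y" using w YZ(3) by blast
          ultimately show "y \<in> Y \<inter> Z" using YZ(4)[of y w] w by blast
        qed
        let ?Z = "insert v (Y \<inter> Z) - X"
        have b2: "Y \<inter> Z \<subseteq> ?b \<union> ?Z"
        proof
          fix y assume y: "y \<in> Y \<inter> Z"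
          then have "y \<in> ?U" using YZ(3) by blast
          then have "y \<notin> X \<or> y = v \<or> y \<in> ?b" using bv by auto
          then show "y \<in> ?b \<union> ?Z" using y v by blast
        qed
        \<comment> \<open>The new bag counts only the boundary of \<open>insert v X\<close> and the
          separator; roots in \<open>Y\<close> also lie in \<open>Z\<close>, hence in the separator.
          The enlarged set has a boundary of at most \<open>n - 1\<close> vertices, against the
          maximality of \<open>X\<close>.\<close>
        have "good E ?k V S (?X \<union> Y)"
        proof (rule good_extend[OF fin sym good])
          show "?Z \<subseteq> ?X \<union> Y - X" by blast
          show "S \<inter> (?X \<union> Y - X) \<subseteq> ?Z" using YZ(2,3) by blast
          show "boundary E V (?X \<union> Y) \<subseteq> ?b \<union> ?Z" using b1 b2 by blast
          show "X \<subseteq> ?X \<union> Y" "?X \<union> Y \<subseteq> V" using v X_V YZ(3) by auto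
          have "card (?b \<union> ?Z) \<le> card (insert v ?b \<union> (Y \<inter> Z))"
            using finb finYZ by (intro card_mono) auto
          also have "\<dots> \<le> card (insert v ?b) + card (Y \<inter> Z)" by (rule card_Un_le)
          also have "\<dots> \<le> n + (n - 1)" using small cb' bv by simp
          finally show "card (?b \<union> ?Z) \<le> ?k" using n by linarith
        qed
        moreover have "X \<subset> ?X \<union> Y" using v by blast
        ultimately have "n - 1 < card (boundary E V (?X \<union> Y))" using maxX by blast
        also have "\<dots> \<le> card (Y \<inter> Z)" using b1 finYZ by (rule card_mono[rotated])
        finally show False using small by simp
      qed
    qed (use X_V v boundary_subset[of E V "insert v X"] in auto)
    then obtain I P where I: "finite I" "card I = n" "connector_family E ?U ?b' (S \<inter> ?U) I P" by blast
    have "finite ?b'" using bv finb by simp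
    then obtain Q where Q: "connector_family E ?U ?b' (S \<inter> ?U) ?b' Q" "\<And>y. y \<in> ?b' \<Longrightarrow> Q y \<inter> ?b' = {y}"
      using connector_family_reindex[OF I(3) I(1), of ?b'] I(2) cb' by auto
    obtain B'' where "tree_model E par (Suc (n - 1)) (?X \<union> ?U) (S \<inter> ?U) B''"
      by (rule tree_model_extend[OF sym B' boundary_subset _ Q par]) auto
    moreover have "?X \<union> ?U = V" "Suc (n - 1) = n" using X_V v n by auto
    ultimately have "tree_model E par n V (S \<inter> ?U) B''" by simp
    then have "tree_model E par n V S B''" unfolding tree_model_def by blast
    then show False using nomodel by blast
  qed
  then obtain H l r where "core_decomposition E ?k V (S \<inter> V \<union> boundary E V V) H l r"
    unfolding good_def by blast
  moreover have "S \<inter> V \<union> boundary E V V = S" using SV unfolding boundary_def by blast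
  ultimately show thesis using that by metis
qed

section \<open>Layerings\<close>

text \<open>For symmetric \<open>E\<close> the last condition says that layers of adjacent vertices
  differ by at most one.\<close>

definition layered_interval_rep ::
  "('a \<Rightarrow> 'a \<Rightarrow> bool) \<Rightarrow> nat \<Rightarrow> 'a set \<Rightarrow> ('a \<Rightarrow> nat) \<Rightarrow> ('a \<Rightarrow> nat) \<Rightarrow> ('a \<Rightarrow> nat) \<Rightarrow> bool" where
  "layered_interval_rep E k C l r ly \<longleftrightarrow> interval_rep E C l r \<and>
     (\<forall>j. interval_width_le l r {v \<in> C. ly v = j} k) \<and>
     (\<forall>u\<in>C. \<forall>v\<in>C. E u v \<longrightarrow> ly v \<le> Suc (ly u))"

lemma interval_width_le_mono:
  assumes "interval_width_le l r H k" "finite H" "A \<subseteq> H"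
  shows "interval_width_le l r A k"
  unfolding interval_width_le_def
proof
  fix t
  have "card {v \<in> A. l v \<le> t \<and> t \<le> r v} \<le> card {v \<in> H. l v \<le> t \<and> t \<le> r v}"
    using assms(2,3) by (intro card_mono) auto
  then show "card {v \<in> A. l v \<le> t \<and> t \<le> r v} \<le> k"
    using assms(1) le_trans unfolding interval_width_le_def by blast
qed

text \<open>\<open>R\<close> is what can be reached from \<open>U\<close> inside \<open>M\<close>,
  obtained as the least closed superset of \<open>U\<close>. It is connected: if a non-empty set
  closed in \<open>R\<close> missed \<open>U\<close>, its complement in \<open>R\<close> would be a
  smaller closed superset.\<close>

lemma reachable_hull:
  assumes sym: "symp E" and U: "conn E U" "U \<noteq> {}" "U \<subseteq> M"
  obtains R where "U \<subseteq> R" "R \<subseteq> M" "conn E R" "\<And>p q. p \<in> R \<Longrightarrow> q \<in> M \<Longrightarrow> E p q \<Longrightarrow> q \<in> R"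
proof -
  define closed where "closed Q \<longleftrightarrow> U \<subseteq> Q \<and> Q \<subseteq> M \<and> (\<forall>p\<in>Q. \<forall>q\<in>M. E p q \<longrightarrow> q \<in> Q)" for Q
  define R where "R = \<Inter>{Q. closed Q}"
  have "closed M" using U unfolding closed_def by blast
  then have R: "U \<subseteq> R" "R \<subseteq> M" unfolding R_def closed_def by blast+
  have step: "q \<in> R" if "p \<in> R" "q \<in> M" "E p q" for p q
    using that unfolding R_def closed_def by blast
  have least: "R \<subseteq> Q" if "closed Q" for Q using that unfolding R_def by blast
  have "conn E R"
  proof (rule connI)
    fix Q x assume Q: "Q \<subseteq> R" "x \<in> Q" and stepQ: "\<And>p q. p \<in> Q \<Longrightarrow> q \<in> R \<Longrightarrow> E p q \<Longrightarrow> q \<in> Q"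
    show "R \<subseteq> Q"
    proof (cases "Q \<inter> U = {}")
      case True
      have "q \<in> R - Q" if "p \<in> R - Q" "q \<in> M" "E p q" for p q
        using that step stepQ[of q p] sympD[OF sym] by blast
      then have "closed (R - Q)" using True R unfolding closed_def by blast
      then show ?thesis using least Q by blast
    next
      case False
      then obtain u where "u \<in> U" "u \<in> Q" by blast
      then have "y \<in> Q" if "y \<in> U" for y
        using connD[OF U(1), of u "\<lambda>z. z \<in> Q" y] stepQ R(1) that by blast
      moreover have "q \<in> Q" if "p \<in> Q" "q \<in> M" "E p q" for p q
        using that step[of p q] stepQ[of p q] Q(1) by blast
      ultimately have "closed Q" using Q(1) R(2) unfolding closed_def by blast
      then show ?thesis by (rule least)
    qed
  qed
  then show thesis using that R step by blast
qed

text \<open>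
  With the core chosen smallest possible, no core vertex \<open>h\<close> is cut off from \<open>U\<close> by the
  part \<open>D\<close> of a bag outside the core: otherwise everything cut off from \<open>U\<close> could be
  moved into that bag.
\<close>

lemma minimal_core_attached:
  assumes fin: "finite C" and sym: "symp E" and U: "conn E U" "U \<noteq> {}" "U \<inter> C = {}"
    and SU: "\<And>s. s \<in> S \<Longrightarrow> \<exists>u\<in>U. E u s"
    and core: "core_decomposition E k C S H l r"
    and min: "\<And>H' l' r'. core_decomposition E k C S H' l' r' \<Longrightarrow> card H \<le> card H'"
  obtains R where "conn E R" "R \<noteq> {}" "R \<subseteq> U \<union> C" "R \<inter> {v \<in> C - H. l v = t} = {}" "H \<subseteq> R"
proof -
  let ?D = "{v \<in> C - H. l v = t}"
  have H: "S \<subseteq> H" "H \<subseteq> C" "interval_rep E C l r" "\<And>v. v \<in> C - H \<Longrightarrow> l v = r v" "interval_width_le l r H k"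
    using core unfolding core_decomposition_def by auto
  have finH: "finite H" using H(2) fin finite_subset by blast
  let ?M = "U \<union> (C - ?D)"
  obtain R where R: "U \<subseteq> R" "R \<subseteq> ?M" "conn E R" "\<And>p q. p \<in> R \<Longrightarrow> q \<in> ?M \<Longrightarrow> E p q \<Longrightarrow> q \<in> R"
    by (rule reachable_hull[OF sym U(1,2), of ?M]) auto
  define K where "K = C - ?D - R"
  \<comment> \<open>Roots are adjacent to \<open>U\<close> and lie in \<open>?M\<close>, hence in
    \<open>R\<close>; so taking \<open>K\<close> out of the core removes no root.\<close>
  have SK: "S \<inter> K = {}"
  proof -
    have "s \<in> R" if "s \<in> S" for s
    proof -
      obtain u where "u \<in> U" "E u s" using SU \<open>s \<in> S\<close> by blast
      moreover have "s \<in> ?M" using H(1,2) \<open>s \<in> S\<close> by blast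
      ultimately show ?thesis using R(1,4) by blast
    qed
    then show ?thesis unfolding K_def by blast
  qed
  define l' where "l' v = (if v \<in> K then t else l v)" for v
  define r' where "r' v = (if v \<in> K then t else r v)" for v
  \<comment> \<open>Within \<open>C\<close>, neighbours of \<open>K\<close> lie in \<open>K\<close>
    or \<open>?D\<close>. After the move all of these occupy just bag \<open>t\<close>, so every
    edge at \<open>K\<close> stays covered.\<close>
  have KD: "v \<in> K \<or> v \<in> ?D" if "v \<in> C" "u \<in> K" "E u v \<or> E v u" for u v
    using that R(4)[of v u] sympD[OF sym] unfolding K_def by blast
  have at_t: "l' v = t" "r' v = t" if "v \<in> K \<or> v \<in> ?D" for v
    using that H(4)[of v] unfolding l'_def r'_def by auto
  have "interval_rep E C l' r'"
    unfolding interval_rep_def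
  proof (intro conjI ballI impI)
    fix v assume "v \<in> C" then show "l' v \<le> r' v"
      using H(3) unfolding interval_rep_def l'_def r'_def by simp
  next
    fix u v assume uv: "u \<in> C" "v \<in> C" "E u v"
    show "l' u \<le> r' v"
    proof (cases "u \<in> K \<or> v \<in> K")
      case True
      then have "(u \<in> K \<or> u \<in> ?D) \<and> (v \<in> K \<or> v \<in> ?D)"
        using KD[of v u] KD[of u v] uv by blast
      then show ?thesis using at_t by simp
    next
      case False
      then show ?thesis using interval_repD(1)[OF H(3) sym uv] unfolding l'_def r'_def by simp
    qed
  qed
  moreover have "interval_width_le l' r' (H - K) k"
    using interval_width_le_mono[OF H(5) finH, of "H - K"]
    unfolding interval_width_le_def l'_def r'_def by (simp cong: conj_cong)
  moreover have "\<forall>v\<in>C - (H - K). l' v = r' v" using H(4) unfolding l'_def r'_def by auto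
  ultimately have "core_decomposition E k C S (H - K) l' r'"
    using H(1,2) SK unfolding core_decomposition_def by blast
  then have "card H \<le> card (H - K)" by (rule min)
  then have "H - K = H" using finH by (intro card_subset_eq) (auto intro: card_mono antisym)
  then have HR: "H \<subseteq> R" using H(2) unfolding K_def by blast
  have "R \<inter> ?D = {}" using R(2) U(3) by blast
  moreover have "R \<noteq> {}" "R \<subseteq> U \<union> C" using R(1,2) U(2) by blast+
  ultimately show thesis using that R(3) HR by blast
qed

text \<open>
  Bag \<open>t\<close> of the core is replaced by \<open>N\<close> bags with the indices \<open>t * N + i\<close>, \<open>i < N\<close>,
  which host the decomposition of \<open>D t\<close>; the core becomes the bottom layer.
\<close>

lemma layered_combine:
  assumes fin: "finite C" and sym: "symp E"
    and core: "core_decomposition E k C S H l r"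
    and D: "\<And>t. D t = {v \<in> C - H. l v = t}"
    and parts: "\<And>t. layered_interval_rep E k (D t) (ll t) (rr t) (ly t)"
    and bottom: "\<And>t u v. u \<in> H \<Longrightarrow> v \<in> D t \<Longrightarrow> E u v \<Longrightarrow> ly t v = 0"
  obtains l' r' ly' where "layered_interval_rep E k C l' r' ly'" "\<And>v. v \<in> S \<Longrightarrow> ly' v = 0"
proof -
  have H: "S \<subseteq> H" "H \<subseteq> C" "interval_rep E C l r" "\<And>v. v \<in> C - H \<Longrightarrow> l v = r v" "interval_width_le l r H k"
    using core unfolding core_decomposition_def by auto
  have finH: "finite H" using H(2) fin finite_subset by blast
  have "finite ((\<lambda>v. rr (l v) v) ` C)" using fin by simp
  then obtain M where M0: "\<And>v. v \<in> C \<Longrightarrow> rr (l v) v < M"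
    unfolding finite_nat_set_iff_bounded by blast
  \<comment> \<open>All offsets are below \<open>N\<close> and \<open>M\<close> is the last one. So
    division by \<open>N\<close> recovers the old bag, and a core vertex fills its blocks from the
    first index of block \<open>l v\<close> to the last of block \<open>r v\<close>.\<close>
  define N where "N = Suc M"
  have N: "0 < N" "M < N" and M: "\<And>v. v \<in> C \<Longrightarrow> rr (l v) v < N" using M0 unfolding N_def by (auto intro: less_SucI)
  define l' where "l' v = (if v \<in> H then l v * N else l v * N + ll (l v) v)" for v
  define r' where "r' v = (if v \<in> H then r v * N + M else l v * N + rr (l v) v)" for v
  define ly' where "ly' v = (if v \<in> H then 0 else Suc (ly (l v) v))" for v
  have rep: "interval_rep E (D t) (ll t) (rr t)"
    "\<And>j. interval_width_le (ll t) (rr t) {v \<in> D t. ly t v = j} k"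
    "\<And>u v. u \<in> D t \<Longrightarrow> v \<in> D t \<Longrightarrow> E u v \<Longrightarrow> ly t v \<le> Suc (ly t u)" for t
    using parts[of t] unfolding layered_interval_rep_def by auto
  have inD: "v \<in> D (l v)" if "v \<in> C - H" for v using that D by blast
  have llrr: "ll (l v) v \<le> rr (l v) v" if "v \<in> C - H" for v
    using rep(1) inD[OF that] unfolding interval_rep_def by blast
  have lr: "l v \<le> r v" if "v \<in> C" for v using H(3) that unfolding interval_rep_def by blast
  \<comment> \<open>Adjacent non-core vertices occupy one bag each, hence the same one; no edge
    joins two different parts.\<close>
  have same: "l u = l v" if "u \<in> C - H" "v \<in> C - H" "E u v" for u v
    using interval_repD[OF H(3) sym _ _ that(3)] H(4)[OF that(1)] H(4)[OF that(2)] that by auto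
  have divl: "l' v div N = l v" if "v \<in> C" for v
    using M[OF that] llrr[of v] N that unfolding l'_def by auto
  have divr: "r' v div N = r v" if "v \<in> C" for v
    using M[OF that] N H(4)[of v] that unfolding r'_def by auto
  have "interval_rep E C l' r'"
    unfolding interval_rep_def
  proof (intro conjI ballI impI)
    fix v assume "v \<in> C"
    then show "l' v \<le> r' v" using lr[of v] llrr[of v] unfolding l'_def r'_def
      by (auto intro: trans_le_add1)
  next
    fix u v assume uv: "u \<in> C" "v \<in> C" "E u v"
    have luv: "l u \<le> r v" using interval_repD(1)[OF H(3) sym uv] .
    consider "v \<in> H" | "v \<notin> H" "u \<in> H" | "v \<notin> H" "u \<notin> H" by blast
    then show "l' u \<le> r' v"
    proof cases
      case 1
      have "l' u div N \<le> r v" using divl uv luv by simp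
      then have "l' u < Suc (r v) * N" using N(1) by (metis div_less_iff_less_mult less_Suc_eq_le)
      then show ?thesis using 1 unfolding r'_def N_def by simp
    next
      case 2
      then have "l u \<le> l v" using luv H(4)[of v] uv by simp
      then show ?thesis using 2 unfolding l'_def r'_def by (simp add: trans_le_add1)
    next
      case 3
      then have e: "l u = l v" using same uv by blast
      have "ll (l v) u \<le> rr (l v) v"
        using interval_repD(1)[OF rep(1)[of "l v"] sym _ _ uv(3)] inD[of u] inD[of v] e 3 uv by simp
      then show ?thesis using 3 e unfolding l'_def r'_def by simp
    qed
  qed
  moreover have "interval_width_le l' r' {v \<in> C. ly' v = j} k" for j
    unfolding interval_width_le_def
  proof
    fix t
    let ?A = "{v \<in> {v \<in> C. ly' v = j}. l' v \<le> t \<and> t \<le> r' v}"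
    have tdiv: "l v \<le> t div N" "t div N \<le> r v" if "v \<in> ?A" for v
      using that divl[of v] divr[of v] div_le_mono[of "l' v" t N] div_le_mono[of t "r' v" N] by auto
    show "card ?A \<le> k"
    proof (cases j)
      case 0
      have "?A \<subseteq> {v \<in> H. l v \<le> t div N \<and> t div N \<le> r v}"
      proof
        fix v assume v: "v \<in> ?A"
        then have "v \<in> H" using 0 unfolding ly'_def by (auto split: if_splits)
        then show "v \<in> {v \<in> H. l v \<le> t div N \<and> t div N \<le> r v}" using tdiv[OF v] by blast
      qed
      then have "card ?A \<le> card {v \<in> H. l v \<le> t div N \<and> t div N \<le> r v}"
        using finH by (intro card_mono) auto
      then show ?thesis using H(5) le_trans unfolding interval_width_le_def by blast
    next
      case (Suc i)
      let ?B = "{v \<in> {v \<in> D (t div N). ly (t div N) v = i}. ll (t div N) v \<le> t mod N \<and> t mod N \<le> rr (t div N) v}"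
      have "?A \<subseteq> ?B"
      proof
        fix v assume v: "v \<in> ?A"
        then have vH: "v \<in> C - H" using Suc unfolding ly'_def by (auto split: if_splits)
        have e: "l v = t div N" using tdiv[OF v] H(4)[OF vH] by simp
        have "t = (t div N) * N + t mod N" by simp
        moreover have "l' v = (t div N) * N + ll (t div N) v" "r' v = (t div N) * N + rr (t div N) v"
          using vH e unfolding l'_def r'_def by auto
        moreover have "l' v \<le> t" "t \<le> r' v" using v by auto
        ultimately have "ll (t div N) v \<le> t mod N \<and> t mod N \<le> rr (t div N) v" by linarith
        moreover have "ly (t div N) v = i" using v vH e Suc unfolding ly'_def by simp
        ultimately show "v \<in> ?B" using inD[OF vH] e by simp
      qed
      moreover have "finite ?B" using fin D by simp
      ultimately have "card ?A \<le> card ?B" by (rule card_mono[rotated])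
      then show ?thesis using rep(2)[of "t div N" i] le_trans unfolding interval_width_le_def by blast
    qed
  qed
  moreover have "ly' v \<le> Suc (ly' u)" if uv: "u \<in> C" "v \<in> C" "E u v" for u v
  proof -
    consider "v \<in> H" | "v \<notin> H" "u \<in> H" | "v \<notin> H" "u \<notin> H" by blast
    then show ?thesis
    proof cases
      case 2
      then show ?thesis using bottom[OF _ inD[of v] uv(3)] uv unfolding ly'_def by simp
    next
      case 3
      then have "l u = l v" using same uv by blast
      then show ?thesis using 3 rep(3)[of u "l v" v] inD[of u] inD[of v] uv unfolding ly'_def by simp
    qed (simp add: ly'_def)
  qed
  ultimately have "layered_interval_rep E k C l' r' ly'" unfolding layered_interval_rep_def by blast
  moreover have "ly' v = 0" if "v \<in> S" for v using H(1) that unfolding ly'_def by auto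
  ultimately show thesis by (rule that)
qed

text \<open>
  In the recursion the rest of the graph on the side of \<open>U\<close> and the core is a connected set
  attached to all vertices of the next root set, playing the role of the apex vertex.
\<close>

theorem ex_layered_interval_rep:
  assumes fin: "finite V" and sym: "symp E" and k: "0 < k"
    and root: "\<And>C U S. C \<subseteq> V \<Longrightarrow> U \<subseteq> V - C \<Longrightarrow> U \<noteq> {} \<Longrightarrow> conn E U \<Longrightarrow> S \<subseteq> C \<Longrightarrow>
      (\<And>s. s \<in> S \<Longrightarrow> \<exists>u\<in>U. E u s) \<Longrightarrow> \<exists>H l r. core_decomposition E k C S H l r"
    and C: "C \<subseteq> V" "S \<subseteq> C"
    and U: "S \<noteq> {} \<Longrightarrow> U \<noteq> {} \<and> conn E U \<and> U \<subseteq> V - C \<and> (\<forall>s\<in>S. \<exists>u\<in>U. E u s)"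
  shows "\<exists>l r ly. layered_interval_rep E k C l r ly \<and> (\<forall>v\<in>S. ly v = 0)"
  using C U
proof (induction "card C" arbitrary: C S U rule: less_induct)
  case less
  have finC: "finite C" using less.prems(1) fin finite_subset by blast
  show ?case
  proof (cases "C = {}")
    case True
    then show ?thesis using less.prems(2)
      unfolding layered_interval_rep_def interval_rep_def interval_width_le_def by auto
  next
    case False
    have "\<exists>H l r. core_decomposition E k C S H l r \<and> H \<noteq> {} \<and>
      (\<forall>t. \<exists>R. conn E R \<and> R \<noteq> {} \<and> R \<subseteq> V \<and> R \<inter> {v \<in> C - H. l v = t} = {} \<and> H \<subseteq> R)"
    proof (cases "S = {}")
      case True
      \<comment> \<open>Without roots any single vertex can serve as the core, and by itself as the
        apex set for the next step.\<close>
      obtain u where u: "u \<in> C" using False by blast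
      have "interval_width_le (\<lambda>_. 0) (\<lambda>_. 0) {u} k"
        unfolding interval_width_le_def
      proof
        fix t :: nat
        have "card {v \<in> {u}. 0 \<le> t \<and> t \<le> 0} \<le> card {u}" by (rule card_mono) auto
        then show "card {v \<in> {u}. 0 \<le> t \<and> t \<le> 0} \<le> k" using k by simp
      qed
      then have "core_decomposition E k C S {u} (\<lambda>_. 0) (\<lambda>_. 0)"
        using True u unfolding core_decomposition_def interval_rep_def by simp
      moreover have "\<exists>R. conn E R \<and> R \<noteq> {} \<and> R \<subseteq> V \<and> R \<inter> {v \<in> C - {u}. 0 = t} = {} \<and> {u} \<subseteq> R" for t :: nat
        using u less.prems(1) by (intro exI[of _ "{u}"]) auto
      ultimately show ?thesis by blast
    next
      case S: False
      then have U: "U \<noteq> {}" "conn E U" "U \<subseteq> V - C" "\<And>s. s \<in> S \<Longrightarrow> \<exists>u\<in>U. E u s"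
        using less.prems(3) by auto
      define Pr where "Pr = (\<lambda>(H, l, r). core_decomposition E k C S H l r)"
      have "\<exists>x. Pr x" using root[OF less.prems(1) U(3,1,2) less.prems(2) U(4)] unfolding Pr_def by auto
      then obtain x where x: "Pr x" "\<And>y. Pr y \<Longrightarrow> card (fst x) \<le> card (fst y)"
        using ex_has_least_nat[of Pr _ "\<lambda>x. card (fst x)"] by blast
      obtain H l r where "x = (H, l, r)" using prod_cases3 by blast
      then have core: "core_decomposition E k C S H l r"
        and min: "\<And>H' l' r'. core_decomposition E k C S H' l' r' \<Longrightarrow> card H \<le> card H'"
        using x unfolding Pr_def by auto
      have "\<exists>R. conn E R \<and> R \<noteq> {} \<and> R \<subseteq> V \<and> R \<inter> {v \<in> C - H. l v = t} = {} \<and> H \<subseteq> R" for t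
      proof -
        obtain R where "conn E R" "R \<noteq> {}" "R \<subseteq> U \<union> C" "R \<inter> {v \<in> C - H. l v = t} = {}" "H \<subseteq> R"
          by (rule minimal_core_attached[OF finC sym U(2,1) _ U(4) core min, where t = t]) (use U(3) in auto)
        then show ?thesis using U(3) less.prems(1) by blast
      qed
      moreover have "H \<noteq> {}" using core S unfolding core_decomposition_def by blast
      ultimately show ?thesis using core by blast
    qed
    then obtain H l r where core: "core_decomposition E k C S H l r" and "H \<noteq> {}"
      and R: "\<And>t. \<exists>R. conn E R \<and> R \<noteq> {} \<and> R \<subseteq> V \<and> R \<inter> {v \<in> C - H. l v = t} = {} \<and> H \<subseteq> R"
      by blast
    have HC: "H \<subseteq> C" using core unfolding core_decomposition_def by blast
    define D where "D t = {v \<in> C - H. l v = t}" for t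
    \<comment> \<open>These vertices must get layer 0 of their part, that is layer 1 of
      \<open>C\<close>, directly above the core.\<close>
    define S' where "S' t = {v \<in> D t. \<exists>h\<in>H. E h v}" for t
    have "\<exists>l r ly. layered_interval_rep E k (D t) l r ly \<and> (\<forall>v\<in>S' t. ly v = 0)" for t
    proof -
      obtain R where R: "conn E R" "R \<noteq> {}" "R \<subseteq> V" "R \<inter> D t = {}" "H \<subseteq> R"
        using R[of t] unfolding D_def by blast
      have DC: "D t \<subseteq> C - H" unfolding D_def by blast
      then have "D t \<subset> C" using HC \<open>H \<noteq> {}\<close> by blast
      then have "card (D t) < card C" using finC by (rule psubset_card_mono[rotated])
      then show ?thesis
      proof (rule less.hyps[of "D t" "S' t" R])
        show "D t \<subseteq> V" "S' t \<subseteq> D t" using DC less.prems(1) unfolding S'_def by auto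
        show "R \<noteq> {} \<and> conn E R \<and> R \<subseteq> V - D t \<and> (\<forall>s\<in>S' t. \<exists>u\<in>R. E u s)"
          using R unfolding S'_def by blast
      qed
    qed
    then obtain ll rr ly where parts: "\<And>t. layered_interval_rep E k (D t) (ll t) (rr t) (ly t)"
      and bottom: "\<And>t v. v \<in> S' t \<Longrightarrow> ly t v = 0"
      by metis
    have "ly t v = 0" if "u \<in> H" "v \<in> D t" "E u v" for t u v
      using bottom[of v t] that unfolding S'_def by blast
    then obtain l' r' ly' where "layered_interval_rep E k C l' r' ly'" "\<And>v. v \<in> S \<Longrightarrow> ly' v = 0"
      by (rule layered_combine[OF finC sym core D_def parts]) auto
    then show ?thesis by blast
  qed
qed

section \<open>Apex-forests and minor models\<close>

text \<open>Otherwise the first vertex \<open>u\<close> of a longest path in \<open>A\<close> has a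
  neighbour \<open>x\<close> in \<open>A\<close> other than its successor; maximality puts
  \<open>x\<close> on the path, which closes a cycle.\<close>

lemma (in graph) acyclic_graph_low_degree:
  assumes acyclic: "acyclic_graph G" and A: "A \<subseteq> verts G" "A \<noteq> {}"
  shows "\<exists>v\<in>A. \<forall>x\<in>A. \<forall>y\<in>A. v \<rightarrow>\<^bsub>G\<^esub> x \<longrightarrow> v \<rightarrow>\<^bsub>G\<^esub> y \<longrightarrow> x = y"
proof (rule ccontr)
  assume "\<not> ?thesis"
  then have nbr: "\<exists>x\<in>A. v \<rightarrow>\<^bsub>G\<^esub> x \<and> x \<noteq> w" if "v \<in> A" for v w using that by metis
  define Pr where "Pr n \<longleftrightarrow> (\<exists>u p v. apath u p v \<and> set (awalk_verts u p) \<subseteq> A \<and> length p = n)" for n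
  obtain a where "a \<in> A" using A by blast
  then have "Pr 0" using A(1) unfolding Pr_def by (intro exI[of _ a] exI[of _ "[]"]) (auto simp: apath_simps)
  moreover have "\<And>n. Pr n \<Longrightarrow> n \<le> card (verts G)" unfolding Pr_def using length_apath by blast
  ultimately obtain m where m: "Pr m" "\<And>n. Pr n \<Longrightarrow> n \<le> m"
    using GreatestI_nat[of Pr 0 "card (verts G)"] Greatest_le_nat[of Pr _ "card (verts G)"] by blast
  then obtain u p v where p: "apath u p v" "set (awalk_verts u p) \<subseteq> A" "length p = m" unfolding Pr_def by blast
  have uA: "u \<in> A" using hd_in_awalk_verts(2)[OF p(1)] p(2) by blast
  then obtain x where x: "x \<in> A" "u \<rightarrow>\<^bsub>G\<^esub> x" "x \<noteq> head G (hd p)" using nbr by blast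
  then obtain e where e: "e \<in> arcs G" "tail G e = x" "head G e = u"
    using graph_symmetric[OF x(2)] by (auto simp: arcs_ends_conv)
  have "x \<in> set (awalk_verts u p)"
  proof (rule ccontr)
    assume "x \<notin> set (awalk_verts u p)"
    then have "apath x (e # p) v" using e p(1) by (simp add: apath_Cons_iff)
    moreover have "set (awalk_verts x (e # p)) \<subseteq> A" using e p(2) x(1) by simp
    ultimately have "Pr (Suc m)" using p(3) unfolding Pr_def by (metis length_Cons)
    then show False using m(2) by fastforce
  qed
  then obtain q r where qr: "p = q @ r" "awalk u q x"
    using awalk_decomp[OF awalkI_apath[OF p(1)]] by blast
  have "distinct (awalk_verts u q)" using p(1) unfolding qr(1) apath_append_iff by (simp add: apath_def)
  then have "cycle (e # q)"
    unfolding cycle_def using e qr(2) by (intro exI[of _ x]) (auto simp: awalk_Cons_iff)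
  \<comment> \<open>The cycle has length at least three: an empty \<open>q\<close> would make
    \<open>x\<close> equal to \<open>u\<close>, and a single arc would make \<open>x\<close> the
    successor of \<open>u\<close>.\<close>
  moreover have "length q \<noteq> 0" using qr(2) x(2) adj_not_same by (auto simp: awalk_Nil_iff)
  moreover have "length q \<noteq> 1"
  proof
    assume "length q = 1"
    then obtain b where "q = [b]" by (metis One_nat_def length_0_conv length_Suc_conv)
    then show False using qr x(3) by (auto simp: awalk_simps)
  qed
  ultimately have "cycle (e # q) \<and> 3 \<le> length (e # q)" by (cases "length q") auto
  then show False using acyclic unfolding acyclic_graph_def by blast
qed

lemma (in graph) graph_del_vert: "graph (del_vert a)"
proof -
  interpret D: fin_digraph "del_vert a" by (rule fin_digraph_del_vert)
  show ?thesis
  proof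
    fix e assume "e \<in> arcs (del_vert a)"
    then show "tail (del_vert a) e \<noteq> head (del_vert a) e" using no_loops by (simp add: del_vert_simps)
  next
    fix e1 e2 assume "e1 \<in> arcs (del_vert a)" "e2 \<in> arcs (del_vert a)"
      "arc_to_ends (del_vert a) e1 = arc_to_ends (del_vert a) e2"
    then show "e1 = e2" using no_multi_arcs by (simp add: del_vert_simps ends_del_vert)
  next
    show "symmetric (del_vert a)"
      using sym_arcs unfolding symmetric_conv by (simp add: del_vert_simps) metis
  qed
qed

text \<open>If \<open>X\<close> is itself acyclic, an arbitrary vertex takes the part of the apex.
  Stating the degree bound for subsets of \<open>verts X\<close> keeps vertex deletion out of the
  later arguments.\<close>

lemma apex_forest_low_degree:
  assumes "graph X" "apex_forest X" "verts X \<noteq> {}"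
  obtains a where "a \<in> verts X"
    "\<And>A. A \<subseteq> verts X - {a} \<Longrightarrow> A \<noteq> {} \<Longrightarrow>
      \<exists>v\<in>A. \<forall>x\<in>A. \<forall>y\<in>A. v \<rightarrow>\<^bsub>X\<^esub> x \<longrightarrow> v \<rightarrow>\<^bsub>X\<^esub> y \<longrightarrow> x = y"
proof -
  interpret X: graph X by (rule assms(1))
  consider "acyclic_graph X" | a where "a \<in> verts X" "acyclic_graph (X.del_vert a)"
    using assms(2) unfolding apex_forest_def by blast
  then show thesis
  proof cases
    case 1
    obtain a where "a \<in> verts X" using assms(3) by blast
    moreover have "\<exists>v\<in>A. \<forall>x\<in>A. \<forall>y\<in>A. v \<rightarrow>\<^bsub>X\<^esub> x \<longrightarrow> v \<rightarrow>\<^bsub>X\<^esub> y \<longrightarrow> x = y"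
      if "A \<subseteq> verts X - {a}" "A \<noteq> {}" for A
    proof -
      have "A \<subseteq> verts X" using that by blast
      from X.acyclic_graph_low_degree[OF 1 this that(2)] show ?thesis .
    qed
    ultimately show thesis by (rule that)
  next
    case (2 a)
    interpret D: graph "X.del_vert a" by (rule X.graph_del_vert)
    have "\<exists>v\<in>A. \<forall>x\<in>A. \<forall>y\<in>A. v \<rightarrow>\<^bsub>X\<^esub> x \<longrightarrow> v \<rightarrow>\<^bsub>X\<^esub> y \<longrightarrow> x = y"
      if A: "A \<subseteq> verts X - {a}" "A \<noteq> {}" for A
    proof -
      have "A \<subseteq> verts (X.del_vert a)" using A(1) by (simp add: X.verts_del_vert)
      then obtain v where v: "v \<in> A"
        "\<forall>x\<in>A. \<forall>y\<in>A. v \<rightarrow>\<^bsub>X.del_vert a\<^esub> x \<longrightarrow> v \<rightarrow>\<^bsub>X.del_vert a\<^esub> y \<longrightarrow> x = y"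
        using D.acyclic_graph_low_degree[OF 2(2) _ A(2)] by blast
      have "v \<rightarrow>\<^bsub>X.del_vert a\<^esub> x" if "x \<in> A" "v \<rightarrow>\<^bsub>X\<^esub> x" for x
        using that v(1) A(1) by (auto simp: arcs_ends_conv X.del_vert_simps)
      then show ?thesis using v by blast
    qed
    then show thesis by (rule that[OF 2(1)])
  qed
qed

text \<open>A vertex with at most one neighbour in \<open>A\<close> is placed last.\<close>

lemma degenerate_ordering:
  assumes "finite A" "symp F"
    and "\<And>B. B \<subseteq> A \<Longrightarrow> B \<noteq> {} \<Longrightarrow> \<exists>v\<in>B. \<forall>x\<in>B. \<forall>y\<in>B. F v x \<longrightarrow> F v y \<longrightarrow> x = y"
  shows "\<exists>f. bij_betw f {..<card A} A \<and>
    (\<forall>i<card A. \<forall>j<i. \<forall>j'<i. F (f j) (f i) \<longrightarrow> F (f j') (f i) \<longrightarrow> j = j')"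
  using assms(1,3)
proof (induction "card A" arbitrary: A)
  case 0
  then show ?case by (auto simp: bij_betw_def)
next
  case (Suc n)
  then have "A \<noteq> {}" by auto
  then obtain v where v: "v \<in> A" "\<And>x y. x \<in> A \<Longrightarrow> y \<in> A \<Longrightarrow> F v x \<Longrightarrow> F v y \<Longrightarrow> x = y"
    using Suc.prems(2)[of A] by blast
  have n: "n = card (A - {v})" using Suc.hyps(2) v(1) Suc.prems(1) by simp
  have "\<exists>f. bij_betw f {..<card (A - {v})} (A - {v}) \<and>
    (\<forall>i<card (A - {v}). \<forall>j<i. \<forall>j'<i. F (f j) (f i) \<longrightarrow> F (f j') (f i) \<longrightarrow> j = j')"
    using Suc.prems by (intro Suc.hyps(1)[OF n]) auto
  then obtain f where f: "bij_betw f {..<n} (A - {v})"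
    "\<And>i j j'. i < n \<Longrightarrow> j < i \<Longrightarrow> j' < i \<Longrightarrow> F (f j) (f i) \<Longrightarrow> F (f j') (f i) \<Longrightarrow> j = j'"
    unfolding n[symmetric] by blast
  let ?f = "f(n := v)"
  have fA: "f j \<in> A" if "j < n" for j using f(1) that unfolding bij_betw_def by blast
  have inj: "inj_on f {..<n}" using f(1) unfolding bij_betw_def by blast
  have "bij_betw ?f {..<n} (A - {v})" using f(1) by (rule bij_betw_cong[THEN iffD1, rotated]) simp
  then have "bij_betw ?f ({..<n} \<union> {n}) ((A - {v}) \<union> {v})"
    by (rule bij_betw_combine) auto
  moreover have "{..<n} \<union> {n} = {..<Suc n}" "(A - {v}) \<union> {v} = A" using v(1) by auto
  ultimately have "bij_betw ?f {..<Suc n} A" by simp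
  moreover have "j = j'" if i: "i < Suc n" "j < i" "j' < i" "F (?f j) (?f i)" "F (?f j') (?f i)" for i j j'
  proof (cases "i = n")
    case True
    then have "F v (f j)" "F v (f j')" using i assms(2) by (auto dest: sympD)
    then have "f j = f j'" using v(2) fA i True by auto
    then show ?thesis using inj i True by (auto dest: inj_onD)
  next
    case False
    then show ?thesis using f(2)[of i j j'] i by auto
  qed
  ultimately show ?case unfolding Suc.hyps(2)[symmetric] by blast
qed

lemma parent_ordering:
  assumes "finite A" "symp F"
    and "\<And>B. B \<subseteq> A \<Longrightarrow> B \<noteq> {} \<Longrightarrow> \<exists>v\<in>B. \<forall>x\<in>B. \<forall>y\<in>B. F v x \<longrightarrow> F v y \<longrightarrow> x = y"
  obtains f :: "nat \<Rightarrow> 'a" and par :: "nat \<Rightarrow> nat" where "bij_betw f {..<card A} A"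
    "\<And>i. 0 < i \<Longrightarrow> par i < i"
    "\<And>i j. j < i \<Longrightarrow> i < card A \<Longrightarrow> F (f j) (f i) \<Longrightarrow> par i = j"
proof -
  obtain f where f: "bij_betw f {..<card A} A"
    "\<And>i j j'. i < card A \<Longrightarrow> j < i \<Longrightarrow> j' < i \<Longrightarrow> F (f j) (f i) \<Longrightarrow> F (f j') (f i) \<Longrightarrow> j = j'"
    using degenerate_ordering[OF assms] by blast
  \<comment> \<open>A vertex without earlier neighbours gets the default parent 0. This completes
    the forest to a tree, whose models are also models of the forest.\<close>
  define par where "par i = (if \<exists>j<i. F (f j) (f i) then SOME j. j < i \<and> F (f j) (f i) else 0)" for i
  have par: "par i < i \<and> F (f (par i)) (f i)" if "j < i" "F (f j) (f i)" for i j
    using someI[of "\<lambda>j. j < i \<and> F (f j) (f i)" j] that unfolding par_def by auto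
  have "par i < i" if "0 < i" for i
    using par[of _ i] that by (cases "\<exists>j<i. F (f j) (f i)") (auto simp: par_def)
  moreover have "par i = j" if "j < i" "i < card A" "F (f j) (f i)" for i j
    using par[OF that(1,3)] f(2) that by blast
  ultimately show thesis by (rule that[OF f(1)])
qed

section \<open>Translation into minor models and layered path-width\<close>

lemma (in wf_digraph) connected_induce_subgraph_if_conn:
  assumes "conn (\<lambda>u v. u \<rightarrow>\<^bsub>G\<^esub> v) B" "B \<subseteq> verts G" "B \<noteq> {}"
  shows "connected (G \<restriction> B)"
proof -
  interpret H: wf_digraph "G \<restriction> B" by (rule wellformed_induce_subgraph)
  have "u \<rightarrow>\<^sup>*\<^bsub>G \<restriction> B\<^esub> v" if "u \<in> B" "v \<in> B" for u v
  proof (rule connD[OF assms(1), of u "\<lambda>z. u \<rightarrow>\<^sup>*\<^bsub>G \<restriction> B\<^esub> z" v])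
    show "u \<rightarrow>\<^sup>*\<^bsub>G \<restriction> B\<^esub> u" using that(1) by (intro H.reachable_refl) simp
    fix p q assume pq: "p \<in> B" "q \<in> B" "u \<rightarrow>\<^sup>*\<^bsub>G \<restriction> B\<^esub> p" "p \<rightarrow>\<^bsub>G\<^esub> q"
    then have "p \<rightarrow>\<^bsub>G \<restriction> B\<^esub> q" by (auto simp: arcs_ends_conv)
    then show "u \<rightarrow>\<^sup>*\<^bsub>G \<restriction> B\<^esub> q" using pq(3) by (rule H.reachable_adj_trans[rotated])
  qed (use that in auto)
  then show ?thesis
    unfolding connected_def using assms(3)
    by (intro strongly_connectedI H.reachable_mk_symmetricI) auto
qed

text \<open>\<open>U\<close> becomes the branch set of \<open>a\<close>: every other branch set
  meets \<open>S\<close> and so has a neighbour in \<open>U\<close>. Edges avoiding \<open>a\<close>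
  are tree edges by \<open>par\<close>, read from the smaller index to the larger.\<close>

lemma (in graph) minor_model_of_rooted_tree_model:
  fixes X :: "('c, 'd) pre_digraph"
  assumes X: "graph X" "a \<in> verts X"
    and f: "bij_betw f {..<n} (verts X - {a})"
    and par: "\<And>i j. j < i \<Longrightarrow> i < n \<Longrightarrow> f j \<rightarrow>\<^bsub>X\<^esub> f i \<Longrightarrow> par i = j"
    and U: "U \<subseteq> verts G" "U \<noteq> {}" "conn (\<lambda>u v. u \<rightarrow>\<^bsub>G\<^esub> v) U" "U \<inter> C = {}"
    and S: "\<And>s. s \<in> S \<Longrightarrow> \<exists>u\<in>U. u \<rightarrow>\<^bsub>G\<^esub> s"
    and C: "C \<subseteq> verts G" and B: "tree_model (\<lambda>u v. u \<rightarrow>\<^bsub>G\<^esub> v) par n C S B"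
  shows "\<exists>B. minor_model X G B"
proof -
  interpret X: graph X by (rule X(1))
  let ?E = "\<lambda>u v. u \<rightarrow>\<^bsub>G\<^esub> v"
  have disB: "disjoint_family_on B {..<n}"
    and B: "\<And>i. i < n \<Longrightarrow> B i \<subseteq> C" "\<And>i. i < n \<Longrightarrow> conn ?E (B i)" "\<And>i. i < n \<Longrightarrow> B i \<inter> S \<noteq> {}"
      "\<And>i. i < n \<Longrightarrow> 0 < i \<Longrightarrow> \<exists>u\<in>B (par i). \<exists>v\<in>B i. u \<rightarrow>\<^bsub>G\<^esub> v"
    using B unfolding tree_model_def by auto
  define g where "g = the_inv_into {..<n} f"
  have g: "g x < n" "f (g x) = x" if "x \<in> verts X" "x \<noteq> a" for x
    using that f bij_betw_the_inv_into[OF f] f_the_inv_into_f_bij_betw[OF f, of x]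
    unfolding g_def bij_betw_def by auto
  define BB where "BB x = (if x = a then U else B (g x))" for x
  have Uedge: "\<exists>u\<in>U. \<exists>v\<in>B i. u \<rightarrow>\<^bsub>G\<^esub> v" if "i < n" for i using B(3)[OF that] S by blast
  have Bedge: "\<exists>u\<in>B j. \<exists>v\<in>B i. u \<rightarrow>\<^bsub>G\<^esub> v" if "j < i" "i < n" "f j \<rightarrow>\<^bsub>X\<^esub> f i" for i j
    using B(4)[OF that(2)] par[OF that] that(1) by auto
  have "minor_model X G BB"
    unfolding minor_model_def
  proof (intro conjI ballI allI impI)
    fix x assume x: "x \<in> verts X"
    have BBx: "BB x \<subseteq> verts G" "BB x \<noteq> {}" "conn ?E (BB x)"
      using U C B(1,2,3)[of "g x"] g(1)[OF x] unfolding BB_def by auto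
    then show "BB x \<subseteq> verts G" "BB x \<noteq> {}" "connected (G \<restriction> BB x)"
      using connected_induce_subgraph_if_conn by auto
  next
    show "disjoint_family_on BB (verts X)"
      unfolding disjoint_family_on_def
    proof (intro ballI impI)
      fix x y assume xy: "x \<in> verts X" "y \<in> verts X" "x \<noteq> y"
      consider "x = a" | "y = a" | "x \<noteq> a" "y \<noteq> a" by blast
      then show "BB x \<inter> BB y = {}"
      proof cases
        case 1
        then show ?thesis using U(4) B(1)[OF g(1)[OF xy(2)]] xy(3) unfolding BB_def by auto
      next
        case 2
        then show ?thesis using U(4) B(1)[OF g(1)[OF xy(1)]] xy(3) unfolding BB_def by auto
      next
        case 3
        then have "g x \<noteq> g y" using g(2) xy by metis
        then show ?thesis
          using disB g(1)[OF xy(1)] g(1)[OF xy(2)] 3 unfolding BB_def disjoint_family_on_def by simp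
      qed
    qed
  next
    fix x y assume xy: "x \<rightarrow>\<^bsub>X\<^esub> y"
    have v: "x \<in> verts X" "y \<in> verts X" "x \<noteq> y" using X.adj_in_verts[OF xy] X.adj_not_same xy by auto
    have flip: "\<exists>u\<in>P. \<exists>w\<in>Q. u \<rightarrow>\<^bsub>G\<^esub> w" if "\<exists>u\<in>Q. \<exists>w\<in>P. u \<rightarrow>\<^bsub>G\<^esub> w" for P Q
      using that graph_symmetric by blast
    consider "x = a" | "y = a" | "x \<noteq> a" "y \<noteq> a" by blast
    then show "\<exists>u\<in>BB x. \<exists>w\<in>BB y. u \<rightarrow>\<^bsub>G\<^esub> w"
    proof cases
      case 1
      then show ?thesis using Uedge[OF g(1)[OF v(2)]] v(3) unfolding BB_def by auto
    next
      case 2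
      then show ?thesis using flip[OF Uedge[OF g(1)[OF v(1)]]] v(3) unfolding BB_def by auto
    next
      case 3
      note gx = g[OF v(1) 3(1)] and gy = g[OF v(2) 3(2)]
      have "\<exists>u\<in>B (g x). \<exists>w\<in>B (g y). u \<rightarrow>\<^bsub>G\<^esub> w"
      proof (cases "g x < g y")
        case True
        then show ?thesis using Bedge[of "g x" "g y"] gx gy xy by simp
      next
        case False
        then have "g y < g x" using gx gy v(3) by (metis linorder_neqE_nat)
        then show ?thesis using flip Bedge[of "g y" "g x"] gx gy X.graph_symmetric[OF xy] by simp
      qed
      then show ?thesis using 3 unfolding BB_def by simp
    qed
  qed
  then show ?thesis by blast
qed

lemma (in graph) layered_pathwidth_le:
  assumes rep: "layered_interval_rep (\<lambda>u v. u \<rightarrow>\<^bsub>G\<^esub> v) k (verts G) l r ly"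
  shows "layered_pathwidth G \<le> k"
proof -
  have lr: "\<And>v. v \<in> verts G \<Longrightarrow> l v \<le> r v" "\<And>u v. u \<rightarrow>\<^bsub>G\<^esub> v \<Longrightarrow> l u \<le> r v"
    and width: "\<And>j t. card {v \<in> {v \<in> verts G. ly v = j}. l v \<le> t \<and> t \<le> r v} \<le> k"
    and ly: "\<And>u v. u \<rightarrow>\<^bsub>G\<^esub> v \<Longrightarrow> ly v \<le> Suc (ly u)"
    using rep adj_in_verts unfolding layered_interval_rep_def interval_rep_def interval_width_le_def by auto
  have "finite (r ` verts G)" by simp
  then obtain T where T: "\<And>v. v \<in> verts G \<Longrightarrow> r v < T"
    unfolding finite_nat_set_iff_bounded by blast
  define bag where "bag t = {v \<in> verts G. l v \<le> t \<and> t \<le> r v}" for t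
  \<comment> \<open>With \<open>Suc T\<close> bags the list is non-empty even for the empty
    graph.\<close>
  define Ws where "Ws = map bag [0..<Suc T]"
  define L where "L j = {v \<in> verts G. ly v = j}" for j
  have len: "length Ws = Suc T" unfolding Ws_def by simp
  have nth: "Ws ! t = bag t" if "t < Suc T" for t
    using that unfolding Ws_def by (simp del: upt_Suc)
  have "path_decomposition G Ws"
    unfolding path_decomposition_def
  proof (intro conjI allI ballI impI)
    show "Ws \<noteq> []" using len by auto
    fix W assume "W \<in> set Ws"
    then show "W \<subseteq> verts G" unfolding Ws_def bag_def by auto
  next
    fix u v assume uv: "u \<rightarrow>\<^bsub>G\<^esub> v"
    note uv' = adj_in_verts[OF uv]
    let ?t = "max (l u) (l v)"
    have "u \<in> bag ?t" "v \<in> bag ?t"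
      using uv' lr(1) lr(2)[OF uv] lr(2)[OF graph_symmetric[OF uv]] unfolding bag_def by auto
    moreover have "?t < Suc T" using lr(1) T uv' by (meson le_less_trans less_Suc_eq max_less_iff_conj)
    then have "bag ?t \<in> set Ws" using nth_mem[of ?t Ws] nth len by simp
    ultimately show "\<exists>W\<in>set Ws. u \<in> W \<and> v \<in> W" by blast
  next
    fix v assume v: "v \<in> verts G"
    have "{t. t < length Ws \<and> v \<in> Ws ! t} = {l v..r v}"
      using nth len T[OF v] v unfolding bag_def by auto
    then show "\<exists>i j. i \<le> j \<and> {t. t < length Ws \<and> v \<in> Ws ! t} = {i..j}" using lr(1)[OF v] by blast
  qed
  moreover have "layering G L"
    unfolding layering_def
  proof (intro conjI allI impI)
    show "disjoint_family L" unfolding disjoint_family_on_def L_def by auto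
    show "(\<Union>j. L j) = verts G" unfolding L_def by auto
    fix u v assume uv: "u \<rightarrow>\<^bsub>G\<^esub> v"
    have "{u, v} \<subseteq> L (min (ly u) (ly v)) \<union> L (Suc (min (ly u) (ly v)))"
      using ly[OF uv] ly[OF graph_symmetric[OF uv]] adj_in_verts[OF uv] unfolding L_def by auto
    then show "\<exists>i. {u, v} \<subseteq> L i \<union> L (Suc i)" by blast
  qed
  ultimately have "layered_pathwidth G \<le> layered_width Ws L"
    unfolding layered_pathwidth_def by (intro Least_le) blast
  also have "layered_width Ws L \<le> k"
    unfolding layered_width_def
  proof (rule Max.boundedI)
    show "finite {card (Ws ! i \<inter> L j) |i j. i < length Ws}"
      "{card (Ws ! i \<inter> L j) |i j. i < length Ws} \<noteq> {}"
      using layered_width_set_finite_nonempty[OF finite_verts \<open>path_decomposition G Ws\<close>] by blast+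
    fix m assume "m \<in> {card (Ws ! i \<inter> L j) |i j. i < length Ws}"
    then obtain i j where "i < length Ws" "m = card (Ws ! i \<inter> L j)" by blast
    moreover have "bag i \<inter> L j = {v \<in> {v \<in> verts G. ly v = j}. l v \<le> i \<and> i \<le> r v}"
      unfolding bag_def L_def by blast
    ultimately show "m \<le> k" using nth len width[of j i] by simp
  qed
  finally show ?thesis .
qed

theorem theorem1p1:
  fixes X :: "('a, 'b) pre_digraph" and G :: "('c, 'd) pre_digraph"
  assumes "graph X" and "apex_forest X" and "card (verts X) \<ge> 2"
    and "graph G" and "minor_free X G"
  shows "layered_pathwidth G \<le> 2 * card (verts X) - 3"
proof -
  interpret X: graph X by (rule assms(1))
  interpret G: graph G by (rule assms(4))
  let ?E = "\<lambda>u v. u \<rightarrow>\<^bsub>G\<^esub> v"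
  have sym: "symp ?E" by (rule sympI) (rule G.graph_symmetric)
  have "verts X \<noteq> {}" using assms(3) by auto
  then obtain a where a: "a \<in> verts X"
    and low: "\<And>A. A \<subseteq> verts X - {a} \<Longrightarrow> A \<noteq> {} \<Longrightarrow>
      \<exists>v\<in>A. \<forall>x\<in>A. \<forall>y\<in>A. v \<rightarrow>\<^bsub>X\<^esub> x \<longrightarrow> v \<rightarrow>\<^bsub>X\<^esub> y \<longrightarrow> x = y"
    using apex_forest_low_degree[OF assms(1,2)] by metis
  define n where "n = card (verts X - {a})"
  \<comment> \<open>Truncated subtraction does no harm: two vertices in \<open>X\<close> leave at
    least one besides \<open>a\<close>.\<close>
  have n: "0 < n" "2 * n - 1 = 2 * card (verts X) - 3"
    using a assms(3) unfolding n_def by auto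
  obtain f par where f: "bij_betw f {..<n} (verts X - {a})"
    and par: "\<And>i. 0 < i \<Longrightarrow> par i < i"
    and parent: "\<And>i j. j < i \<Longrightarrow> i < n \<Longrightarrow> f j \<rightarrow>\<^bsub>X\<^esub> f i \<Longrightarrow> par i = j"
  proof (rule parent_ordering[of "verts X - {a}" "\<lambda>u v. u \<rightarrow>\<^bsub>X\<^esub> v"])
    show "symp (\<lambda>u v. u \<rightarrow>\<^bsub>X\<^esub> v)" by (rule sympI) (rule X.graph_symmetric)
  qed (use low that in \<open>auto simp: n_def\<close>)
  \<comment> \<open>The recursion starts with no roots, so no apex set has to be supplied.\<close>
  have "\<exists>l r ly. layered_interval_rep ?E (2 * n - 1) (verts G) l r ly \<and> (\<forall>v\<in>{}. ly v = 0)"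
  proof (rule ex_layered_interval_rep[OF G.finite_verts sym])
    fix C U S assume C: "C \<subseteq> verts G" and U: "U \<subseteq> verts G - C" "U \<noteq> {}" "conn ?E U"
      and S: "S \<subseteq> C" "\<And>s. s \<in> S \<Longrightarrow> \<exists>u\<in>U. u \<rightarrow>\<^bsub>G\<^esub> s"
    have "\<not> tree_model ?E par n C S B" for B
    proof
      assume "tree_model ?E par n C S B"
      then have "\<exists>B. minor_model X G B"
        using U C S(2)
        by (intro G.minor_model_of_rooted_tree_model[OF assms(1) a f parent,
            where U = U and C = C and S = S and B = B]) auto
      then show False using assms(5) unfolding minor_free_def by blast
    qed
    then show "\<exists>H l r. core_decomposition ?E (2 * n - 1) C S H l r"
      using core_decomposition_or_rooted_tree_model[OF finite_subset[OF C G.finite_verts] sym S(1) par n(1)]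
      by metis
  qed (use n(1) in auto)
  then show ?thesis using G.layered_pathwidth_le n(2) by metis
qed

end
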